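(* Let $\mathscr{M}$ be a von Neumann algebra acting on the Hilbert space $\mathcal{H}$. For $i=1,2$, let $A_i, B_i \in \mathscr{M}$ with $\mathrm{null}(B_i) \subseteq \mathrm{null}(A_i)$. Then $A_1/B_1 = A_2/B_2$ if and only if there is a right-invertible element $C \in \mathscr{M}$ and projections $P, Q$ in the centre of $\mathscr{M}$ with $P+Q=I$ such that $$A_1 P = A_2 C P,\quad B_1 P = B_2 C P,\quad\text{and}\quad A_2 Q = A_1 C Q,\quad B_2 Q = B_1 C Q.$$
   Context: Hilbert spaces are complex; $\mathcal{B}(\mathcal{H})$ is the set of bounded everywhere-defined operators on $\mathcal{H}$. An unbounded operator on $\mathcal{H}$ is a linear map $T:\mathrm{dom}(T)\to\mathcal{H}$ with $\mathrm{dom}(T)$ a (not necessarily dense) linear subspace of $\mathcal{H}$, and $T$ not necessarily bounded; equality of operators includes equality of domains. For $A,B\in\mathcal{B}(\mathcal{H})$ with $\mathrm{null}(B)\subseteq\mathrm{null}(A)$, the quotient $A/B$ is the unbounded operator on $\mathcal{H}$ with domain $\mathrm{ran}(B)$ given by $Bx\mapsto Ax$ ($x\in\mathcal{H}$). Right-invertible in $\mathscr{M}$ means there is $D\in\mathscr{M}$ with $CD=I$. *)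

theory Defs
  imports "HOL-Analysis.Analysis"
begin

text \<open>
  Complex Hilbert spaces: the real inner product and the norm are those induced by
  the complex inner product, which is linear in its first argument. Positive
  definiteness and completeness are inherited from the two parent classes.
\<close>

class complex_hilbert_space = real_inner + complete_space +
  fixes scaleC :: "complex \<Rightarrow> 'a \<Rightarrow> 'a"  (infixr "*\<^sub>C" 75)
    and cinner :: "'a \<Rightarrow> 'a \<Rightarrow> complex"
  assumes scaleC_add_right: "c *\<^sub>C (x + y) = c *\<^sub>C x + c *\<^sub>C y"
    and scaleC_add_left: "(c + d) *\<^sub>C x = c *\<^sub>C x + d *\<^sub>C x"
    and scaleC_scaleC: "c *\<^sub>C d *\<^sub>C x = (c * d) *\<^sub>C x"
    and scaleC_of_real: "complex_of_real r *\<^sub>C x = r *\<^sub>R x"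
    and cinner_commute: "cinner x y = cnj (cinner y x)"
    and cinner_add_left: "cinner (x + y) z = cinner x z + cinner y z"
    and cinner_scaleC_left: "cinner (c *\<^sub>C x) y = c * cinner x y"
    and inner_eq_Re_cinner: "x \<bullet> y = Re (cinner x y)"

definition bounded_operators :: "('a::complex_hilbert_space \<Rightarrow> 'a) set" where
  "bounded_operators = {T. bounded_linear T \<and> (\<forall>c x. T (c *\<^sub>C x) = c *\<^sub>C T x)}"

definition null_space :: "('a::complex_hilbert_space \<Rightarrow> 'a) \<Rightarrow> 'a set" where
  "null_space T = {x. T x = 0}"

definition is_adjoint ::
  "('a::complex_hilbert_space \<Rightarrow> 'a) \<Rightarrow> ('a \<Rightarrow> 'a) \<Rightarrow> bool" where
  "is_adjoint T S \<longleftrightarrow> (\<forall>x y. cinner (T x) y = cinner x (S y))"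

text \<open>
  The coarsest topology on the bounded operators making every map
  \<open>T \<mapsto> cinner (T x) y\<close> continuous; the function type
  \<open>'a \<times> 'a \<Rightarrow> complex\<close> carries the product topology.
\<close>

definition weak_operator_topology :: "('a::complex_hilbert_space \<Rightarrow> 'a) topology" where
  "weak_operator_topology =
     pullback_topology bounded_operators (\<lambda>T (x, y). cinner (T x) y) euclidean"

definition von_neumann_algebra :: "('a::complex_hilbert_space \<Rightarrow> 'a) set \<Rightarrow> bool" where
  "von_neumann_algebra M \<longleftrightarrow>
     M \<subseteq> bounded_operators \<and>
     id \<in> M \<and>
     (\<forall>S\<in>M. \<forall>T\<in>M. (\<lambda>x. S x + T x) \<in> M) \<and>
     (\<forall>c. \<forall>T\<in>M. (\<lambda>x. c *\<^sub>C T x) \<in> M) \<and>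
     (\<forall>S\<in>M. \<forall>T\<in>M. S \<circ> T \<in> M) \<and>
     (\<forall>T\<in>M. \<exists>S\<in>M. is_adjoint T S) \<and>
     closedin weak_operator_topology M"

definition centre :: "('a::complex_hilbert_space \<Rightarrow> 'a) set \<Rightarrow> ('a \<Rightarrow> 'a) set" where
  "centre M = {T \<in> M. \<forall>S\<in>M. T \<circ> S = S \<circ> T}"

definition is_projection :: "('a::complex_hilbert_space \<Rightarrow> 'a) \<Rightarrow> bool" where
  "is_projection P \<longleftrightarrow> P \<in> bounded_operators \<and> P \<circ> P = P \<and> is_adjoint P P"

definition right_invertible_in ::
  "('a::complex_hilbert_space \<Rightarrow> 'a) set \<Rightarrow> ('a \<Rightarrow> 'a) \<Rightarrow> bool" where
  "right_invertible_in M C \<longleftrightarrow> (\<exists>D\<in>M. C \<circ> D = id)"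

text \<open>
  Unbounded operators are partial maps, so that equality includes equality of domains.
  The description in \<open>operator_quotient A B\<close> is well defined exactly when
  \<open>null_space B \<subseteq> null_space A\<close>.
\<close>

definition operator_quotient ::
  "('a::complex_hilbert_space \<Rightarrow> 'a) \<Rightarrow> ('a \<Rightarrow> 'a) \<Rightarrow> ('a \<rightharpoonup> 'a)" where
  "operator_quotient A B =
     (\<lambda>y. if y \<in> range B then Some (THE z. \<exists>x. B x = y \<and> A x = z) else None)"

lemma dom_operator_quotient: "dom (operator_quotient A B) = range B"
  by (auto simp: operator_quotient_def dom_def)

lemma operator_quotient_apply:
  assumes "A \<in> bounded_operators" "B \<in> bounded_operators"
    and "null_space B \<subseteq> null_space A"
  shows "operator_quotient A B (B x) = Some (A x)"
proof -
  interpret A: bounded_linear A using assms by (simp add: bounded_operators_def)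
  interpret B: bounded_linear B using assms by (simp add: bounded_operators_def)
  have "A x' = A x" if "B x' = B x" for x'
  proof -
    have "x' - x \<in> null_space B" using that by (simp add: null_space_def B.diff)
    then have "x' - x \<in> null_space A" using assms(3) by blast
    then show ?thesis by (simp add: null_space_def A.diff)
  qed
  then have "(THE z. \<exists>x'. B x' = B x \<and> A x' = z) = A x" by blast
  then show ?thesis by (simp add: operator_quotient_def)
qed

end

theory Submission
  imports Defs
begin

text \<open>
  If the quotients agree, then \<open>B1\<close> and \<open>B2\<close> have the same range, so uniform boundedness
  (in the form of Douglas' lemma) gives \<open>V, V'\<close> in the algebra with \<open>B1 = B2 V\<close> and
  \<open>B2 = B1 V'\<close>; if \<open>E, F\<close> are the projections onto the null spaces of \<open>B1, B2\<close>, they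
  can be chosen with \<open>V V' = 1 - F\<close> and \<open>V' V = 1 - E\<close>. Comparison of projections yields a
  partial isometry \<open>W\<close> from part of \<open>E\<close> to part of \<open>F\<close> and a central projection \<open>Q\<close> such
  that \<open>W\<close> exhausts \<open>F\<close> on \<open>Q\<close> and exhausts \<open>E\<close> on \<open>1 - Q\<close>. Then
  \<open>C = (V + W) Q + (V' + W\<^sup>*) (1 - Q)\<close> has the right inverse
  \<open>(V' + W\<^sup>*) Q + (V + W) (1 - Q)\<close>. In the other direction \<open>C P + D Q\<close>, with \<open>D\<close> a right
  inverse of \<open>C\<close>, carries arguments of \<open>A1, B1\<close> to arguments of \<open>A2, B2\<close>.

  The double commutant theorem is not needed: all operators arise as limits of explicit
  nets in the algebra in the strong operator topology.
\<close>

section \<open>Strongly closed algebras of operators\<close>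

text \<open>By Baire's theorem one of the closed sets \<open>A n\<close>, which cover the space,
  contains a ball. Moving from its centre a distance \<open>r\<close> in the direction of
  \<open>s\<close> changes the inner product with \<open>s\<close> by \<open>r * norm s\<close>,
  which is therefore at most \<open>2 * real n\<close>.\<close>

lemma weakly_bounded_imp_bounded:
  fixes S :: "'a::{real_inner,complete_space} set"
  assumes "\<And>h. \<exists>k. \<forall>s\<in>S. \<bar>s \<bullet> h\<bar> \<le> k"
  obtains K where "\<And>s. s \<in> S \<Longrightarrow> norm s \<le> K"
proof -
  define A where "A n = {h. \<forall>s\<in>S. \<bar>s \<bullet> h\<bar> \<le> real n}" for n
  have closed: "closed (A n)" for n
  proof -
    have "A n = (\<Inter>s\<in>S. {h. \<bar>s \<bullet> h\<bar> \<le> real n})" by (auto simp: A_def)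
    then show ?thesis by (auto intro!: closed_Collect_le continuous_intros)
  qed
  have union: "\<Union>(range A) = UNIV"
  proof -
    have "\<exists>n. h \<in> A n" for h
    proof -
      obtain k where "\<forall>s\<in>S. \<bar>s \<bullet> h\<bar> \<le> k" using assms by blast
      moreover obtain n where "k \<le> real n" using real_arch_simple by blast
      ultimately show ?thesis
        by (auto simp: A_def intro!: exI[of _ n] intro: order_trans)
    qed
    then show ?thesis by blast
  qed
  have "\<exists>n. interior (A n) \<noteq> {}"
  proof (rule ccontr)
    assume "\<nexists>n. interior (A n) \<noteq> {}"
    then have "Met_TC.mtopology interior_of \<Union>(range A) = {}"
      using closed by (intro Met_TC.metric_Baire_category_alt) (auto simp: complete_UNIV)
    then show False by (simp add: union)
  qed
  then obtain n h r where r: "0 < r" "cball h r \<subseteq> A n"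
    by (metis all_not_in_conv mem_interior_cball)
  have "norm s \<le> 2 * real n / r" if s: "s \<in> S" for s
  proof (cases "s = 0")
    case False
    let ?v = "(r / norm s) *\<^sub>R s"
    have "h + ?v \<in> cball h r" "h \<in> cball h r" using r(1) False by (auto simp: dist_norm)
    then have "\<bar>s \<bullet> (h + ?v)\<bar> \<le> real n" "\<bar>s \<bullet> h\<bar> \<le> real n"
      using r(2) s unfolding A_def by blast+
    then have "s \<bullet> ?v \<le> 2 * real n" by (simp add: inner_add_right)
    moreover have "s \<bullet> ?v = r * norm s"
      using False by (simp add: power2_norm_eq_inner[symmetric] power2_eq_square)
    ultimately show ?thesis using r(1) by (simp add: field_simps)
  qed (use r(1) in simp)
  then show ?thesis by (rule that)
qed

text \<open>Over the reals, because multiplication by complex scalars plays no role in the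
  comparison argument. The limits range over filters instead of sequences since chains of
  partial isometries need not have countable cofinality.\<close>

locale strongly_closed_star_algebra =
  fixes M :: "('a::{real_inner,complete_space} \<Rightarrow> 'a) set"
  assumes bounded_linear_mem: "T \<in> M \<Longrightarrow> bounded_linear T"
    and id_mem: "(\<lambda>x. x) \<in> M"
    and add_mem: "S \<in> M \<Longrightarrow> T \<in> M \<Longrightarrow> (\<lambda>x. S x + T x) \<in> M"
    and scaleR_mem: "T \<in> M \<Longrightarrow> (\<lambda>x. c *\<^sub>R T x) \<in> M"
    and comp_mem: "S \<in> M \<Longrightarrow> T \<in> M \<Longrightarrow> (\<lambda>x. S (T x)) \<in> M"
    and ex_adjoint: "T \<in> M \<Longrightarrow> \<exists>S\<in>M. \<forall>x y. T x \<bullet> y = x \<bullet> S y"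
    and limit_mem: "F \<noteq> bot \<Longrightarrow> eventually (\<lambda>T. T \<in> M) F \<Longrightarrow>
      eventually (\<lambda>T. \<forall>x. norm (T x) \<le> K * norm x) F \<Longrightarrow>
      (\<And>x. ((\<lambda>T. T x) \<longlongrightarrow> L x) F) \<Longrightarrow> L \<in> M"
begin

lemma adjoint_mem: "T \<in> M \<Longrightarrow> adjoint T \<in> M"
  and inner_adjoint: "T \<in> M \<Longrightarrow> T x \<bullet> y = x \<bullet> adjoint T y"
proof -
  have "adjoint T \<in> M \<and> T x \<bullet> y = x \<bullet> adjoint T y" if "T \<in> M" for T x y
    using ex_adjoint[OF that] adjoint_unique by metis
  then show "T \<in> M \<Longrightarrow> adjoint T \<in> M" "T \<in> M \<Longrightarrow> T x \<bullet> y = x \<bullet> adjoint T y"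
    by auto
qed

lemma adjoint_inner: "T \<in> M \<Longrightarrow> adjoint T x \<bullet> y = x \<bullet> T y"
  by (metis inner_adjoint inner_commute)

lemma adjoint_adjoint: "T \<in> M \<Longrightarrow> adjoint (adjoint T) = T"
  by (rule adjoint_unique) (simp add: adjoint_inner)

lemma linear_mem: "T \<in> M \<Longrightarrow> linear T"
  by (simp add: bounded_linear_mem bounded_linear.linear)

lemmas mem_add = linear_add[OF linear_mem]
  and mem_diff = linear_diff[OF linear_mem]
  and mem_scaleR = linear_scale[OF linear_mem]
  and mem_zero = linear_0[OF linear_mem]
  and mem_tendsto = bounded_linear.tendsto[OF bounded_linear_mem]

lemma zero_mem: "(\<lambda>x. 0) \<in> M"
  using scaleR_mem[OF id_mem, of 0] by simp

lemma diff_mem: "S \<in> M \<Longrightarrow> T \<in> M \<Longrightarrow> (\<lambda>x. S x - T x) \<in> M"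
  using add_mem[OF _ scaleR_mem, of S T "-1"] by simp

lemma sum_mem: "finite I \<Longrightarrow> (\<And>i. i \<in> I \<Longrightarrow> f i \<in> M) \<Longrightarrow> (\<lambda>x. \<Sum>i\<in>I. f i x) \<in> M"
  by (induction I rule: finite_induct) (auto intro: zero_mem add_mem)

lemma funpow_mem: "T \<in> M \<Longrightarrow> T ^^ n \<in> M"
proof (induction n)
  case 0
  then show ?case using id_mem by (simp add: id_def)
next
  case (Suc n)
  then show ?case using comp_mem[of T "T ^^ n"] by (simp add: comp_def)
qed

lemma adjoint_eq_0_iff: "T \<in> M \<Longrightarrow> adjoint T y = 0 \<longleftrightarrow> (\<forall>x. T x \<bullet> y = 0)"
  by (metis inner_adjoint inner_eq_zero_iff inner_zero_right)

lemma sequential_limit_mem: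
  assumes "\<And>n::nat. T n \<in> M" "\<And>n x. norm (T n x) \<le> K * norm x"
    and "\<And>x. (\<lambda>n. T n x) \<longlonglongrightarrow> L x"
  shows "L \<in> M"
proof (rule limit_mem[of "filtermap T sequentially" K])
  show "((\<lambda>T. T x) \<longlongrightarrow> L x) (filtermap T sequentially)" for x
    using assms(3)[of x] by (simp add: filterlim_filtermap)
qed (use assms in \<open>auto simp: eventually_filtermap filtermap_bot_iff\<close>)

definition projection :: "('a \<Rightarrow> 'a) \<Rightarrow> bool" where
  "projection P \<longleftrightarrow> P \<in> M \<and> (\<forall>x. P (P x) = P x) \<and> (\<forall>x y. P x \<bullet> y = x \<bullet> P y)"

lemma projection_mem: "projection P \<Longrightarrow> P \<in> M"
  and projection_idem: "projection P \<Longrightarrow> P (P x) = P x"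
  and projection_inner: "projection P \<Longrightarrow> P x \<bullet> y = x \<bullet> P y"
  by (auto simp: projection_def)

lemma projection_complement: "projection P \<Longrightarrow> projection (\<lambda>x. x - P x)"
  by (auto simp: projection_def mem_diff inner_diff intro: diff_mem id_mem)

text \<open>The square of \<open>norm (adjoint T x)\<close> is
  \<open>T (adjoint T x) \<bullet> x\<close>; Cauchy-Schwarz and the bound on \<open>T\<close> leave
  one factor to cancel.\<close>

lemma adjoint_norm_le:
  assumes T: "T \<in> M" and K: "\<And>x. norm (T x) \<le> K * norm x" and K0: "0 \<le> K"
  shows "norm (adjoint T x) \<le> K * norm x"
proof -
  have "norm (adjoint T x) * norm (adjoint T x) = T (adjoint T x) \<bullet> x"
    by (simp add: inner_adjoint[OF T] power2_norm_eq_inner flip: power2_eq_square)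
  also have "\<dots> \<le> (K * norm (adjoint T x)) * norm x"
    using norm_cauchy_schwarz[of "T (adjoint T x)" x] mult_right_mono[OF K[of "adjoint T x"] norm_ge_zero[of x]]
    by linarith
  finally have *: "norm (adjoint T x) * norm (adjoint T x) \<le> norm (adjoint T x) * (K * norm x)"
    by (simp add: ac_simps)
  show ?thesis
  proof (cases "norm (adjoint T x) = 0")
    case False
    then show ?thesis using * by simp
  qed (use K0 in simp)
qed

section \<open>Null projections and quotients\<close>

text \<open>With \<open>R = 1 - B\<^sup>*B\<close> the numbers \<open>R\<^sup>nx \<bullet> x\<close> decrease, and
  \<open>norm (R\<^sup>mx - R\<^sup>nx)\<close> is controlled by them because \<open>R\<^sup>mx \<bullet> R\<^sup>nx = R\<^sup>m\<^sup>+\<^sup>nx \<bullet> x\<close>.\<close>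

lemma contraction_powers_converge:
  assumes B: "B \<in> M" and contr: "\<And>x. norm (B x) \<le> norm x"
  defines "R \<equiv> \<lambda>x. x - adjoint B (B x)"
  shows "\<exists>E. projection E \<and> (\<forall>x. (\<lambda>n. (R ^^ n) x) \<longlonglongrightarrow> E x) \<and>
    (\<forall>n x. norm ((R ^^ n) x) \<le> norm x) \<and>
    (\<forall>x. E x = x \<longleftrightarrow> B x = 0) \<and> (\<forall>x. B (E x) = 0)"
proof -
  have B': "adjoint B \<in> M" using B by (rule adjoint_mem)
  have R: "R \<in> M" unfolding R_def by (rule diff_mem[OF id_mem comp_mem[OF B' B]])
  have Rn: "R ^^ n \<in> M" for n using R by (rule funpow_mem)
  have contr': "norm (adjoint B x) \<le> norm x" for x
    using adjoint_norm_le[OF B, of 1] contr by simp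
  have R_inner: "R x \<bullet> y = x \<bullet> R y" for x y
    by (simp add: R_def inner_diff adjoint_inner[OF B] inner_adjoint[OF B])
  have Rx: "R x \<bullet> x = (norm x)\<^sup>2 - (norm (B x))\<^sup>2" for x
    by (simp add: R_def inner_diff adjoint_inner[OF B] power2_norm_eq_inner)
  have pos: "0 \<le> R x \<bullet> x" for x
    using contr[of x] by (simp add: Rx)
  have dec: "R x \<bullet> x \<le> x \<bullet> x" for x
    by (simp add: Rx flip: power2_norm_eq_inner)
  \<comment> \<open>The gap is
    \<open>(norm (B x))\<^sup>2 - (norm (adjoint B (B x)))\<^sup>2\<close>, nonnegative because the
    adjoint is a contraction too.\<close>
  have dec2: "R x \<bullet> R x \<le> R x \<bullet> x" for x
  proof -
    have "R x \<bullet> x - R x \<bullet> R x = R x \<bullet> adjoint B (B x)"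
      by (simp add: R_def inner_diff inner_commute)
    also have "\<dots> = (norm (B x))\<^sup>2 - (norm (adjoint B (B x)))\<^sup>2"
      by (simp add: R_def inner_diff mem_diff[OF B] inner_adjoint[OF B, symmetric] power2_norm_eq_inner)
    also have "\<dots> \<ge> 0" using contr'[of "B x"] by simp
    finally show ?thesis by simp
  qed
  have contrR: "norm (R x) \<le> norm x" for x
    using dec[of x] dec2[of x] by (simp add: norm_le)
  have contrRn: "norm ((R ^^ n) x) \<le> norm x" for n x
    by (induction n) (auto intro: order_trans contrR)
  have Rn_inner: "(R ^^ n) x \<bullet> y = x \<bullet> (R ^^ n) y" for n x y
  proof (induction n arbitrary: x y)
    case (Suc n)
    then show ?case by (simp add: R_inner funpow_swap1)
  qed simp
  \<comment> \<open>With \<open>v = (R ^^ j) x\<close>, an even index gives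
    \<open>v \<bullet> v\<close> and an odd one \<open>R v \<bullet> v\<close>. Hence the decrease
    alternates between \<open>dec\<close> and \<open>dec2\<close>.\<close>
  define a where "a x k = (R ^^ k) x \<bullet> x" for x k
  have mn: "(R ^^ m) x \<bullet> (R ^^ n) x = a x (m + n)" for x m n
    using Rn_inner[of n "(R ^^ m) x" x]
    by (simp add: a_def add.commute[of m n] funpow_add)
  have a_even: "a x (2 * k) = (R ^^ k) x \<bullet> (R ^^ k) x" for x k
    by (simp add: mn mult_2)
  have a_odd: "a x (Suc (2 * k)) = R ((R ^^ k) x) \<bullet> (R ^^ k) x" for x k
    using mn[of "Suc k" x k] by (simp add: mult_2)
  have a_pos: "0 \<le> a x k" for x k
  proof (cases "even k")
    case True
    then obtain j where "k = 2 * j" by blast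
    then show ?thesis by (simp add: a_even)
  next
    case False
    then obtain j where "k = Suc (2 * j)" by (metis oddE Suc_eq_plus1)
    then show ?thesis using a_odd[of x j] pos by simp
  qed
  have a_dec: "a x (Suc k) \<le> a x k" for x k
  proof (cases "even k")
    case True
    then obtain j where "k = 2 * j" by blast
    then show ?thesis using a_odd[of x j] dec by (simp add: a_even)
  next
    case False
    then obtain j where j: "k = Suc (2 * j)" by (metis oddE Suc_eq_plus1)
    have "a x (Suc k) = a x (2 * Suc j)" using j by simp
    then show ?thesis using a_odd[of x j] dec2 j by (simp only: a_even) simp
  qed
  have conv_a: "Cauchy (a x)" for x
  proof -
    have "decseq (a x)" using a_dec by (simp add: decseq_Suc_iff)
    then have "convergent (a x)"
      by (metis a_pos convergentI decseq_convergent)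
    then show ?thesis by (rule convergent_Cauchy)
  qed
  have conv: "convergent (\<lambda>n. (R ^^ n) x)" for x
  proof (rule Cauchy_convergent, rule metric_CauchyI)
    fix e :: real assume e: "0 < e"
    obtain N where N: "\<And>m n. m \<ge> N \<Longrightarrow> n \<ge> N \<Longrightarrow> dist (a x m) (a x n) < e\<^sup>2 / 2"
      using conv_a[of x] e unfolding Cauchy_def by (metis half_gt_zero zero_less_power)
    have "dist ((R ^^ m) x) ((R ^^ n) x) < e" if "m \<ge> N" "n \<ge> N" for m n
    proof -
      have "(dist ((R ^^ m) x) ((R ^^ n) x))\<^sup>2 = a x (m + m) - 2 * a x (m + n) + a x (n + n)"
        using mn[of m x m] mn[of m x n] mn[of n x m] mn[of n x n]
        by (simp add: dist_norm power2_norm_eq_inner inner_diff add.commute)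
      also have "\<dots> < e\<^sup>2"
        using N[of "m + m" "m + n"] N[of "n + n" "m + n"] that
        unfolding dist_real_def by (smt (verit) field_sum_of_halves trans_le_add1)
      finally show ?thesis using e by (simp add: power_less_imp_less_base)
    qed
    then show "\<exists>N. \<forall>m\<ge>N. \<forall>n\<ge>N. dist ((R ^^ m) x) ((R ^^ n) x) < e" by blast
  qed
  define E where "E x = lim (\<lambda>n. (R ^^ n) x)" for x
  have lim: "(\<lambda>n. (R ^^ n) x) \<longlonglongrightarrow> E x" for x
    using conv[of x] by (simp add: E_def convergent_LIMSEQ_iff)
  have E: "E \<in> M"
    by (rule sequential_limit_mem[of "\<lambda>n. R ^^ n" 1]) (auto simp: Rn lim contrRn)
  have E_inner: "E x \<bullet> y = x \<bullet> E y" for x y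
  proof (rule LIMSEQ_unique)
    show "(\<lambda>n. (R ^^ n) x \<bullet> y) \<longlonglongrightarrow> E x \<bullet> y" by (intro tendsto_intros lim)
    show "(\<lambda>n. (R ^^ n) x \<bullet> y) \<longlonglongrightarrow> x \<bullet> E y"
      unfolding Rn_inner by (intro tendsto_intros lim)
  qed
  have RE: "R (E x) = E x" for x
  proof (rule LIMSEQ_unique)
    show "(\<lambda>n. R ((R ^^ n) x)) \<longlonglongrightarrow> R (E x)" by (rule mem_tendsto[OF R lim])
    show "(\<lambda>n. R ((R ^^ n) x)) \<longlonglongrightarrow> E x"
      using LIMSEQ_Suc[OF lim[of x]] by simp
  qed
  have R_fix: "E x = x" if "R x = x" for x
  proof -
    have "(R ^^ n) x = x" for n by (induction n) (auto simp: that)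
    then show ?thesis using lim[of x] by (simp add: LIMSEQ_const_iff)
  qed
  \<comment> \<open>\<open>adjoint B (B v) = 0\<close> forces \<open>B v = 0\<close>, since pairing
    it with \<open>v\<close> yields \<open>B v \<bullet> B v\<close>.\<close>
  have BE: "B (E x) = 0" for x
  proof -
    have "adjoint B (B (E x)) = 0" using RE[of x] by (simp add: R_def)
    then show ?thesis using inner_adjoint[OF B, of "E x" "B (E x)"] by simp
  qed
  have "E x = x \<longleftrightarrow> B x = 0" for x
  proof
    show "E x = x \<Longrightarrow> B x = 0" using BE[of x] by simp
    show "B x = 0 \<Longrightarrow> E x = x" by (rule R_fix) (simp add: R_def mem_zero[OF B'])
  qed
  moreover have "projection E"
    unfolding projection_def using E E_inner RE R_fix by blast
  ultimately show ?thesis using lim BE contrRn by blast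
qed

lemma ex_contraction_scaling:
  assumes "B \<in> M"
  obtains K where "K > 0" "(\<lambda>x. (1 / K) *\<^sub>R B x) \<in> M" "\<And>x. norm ((1 / K) *\<^sub>R B x) \<le> norm x"
proof -
  obtain K where "K > 0" "\<And>x. norm (B x) \<le> norm x * K"
    using bounded_linear.pos_bounded[OF bounded_linear_mem[OF assms]] by blast
  then show ?thesis by (intro that[of K] scaleR_mem assms) (auto simp: field_simps)
qed

text \<open>Positive rescaling makes \<open>B\<close> a contraction without changing its null space,
  so the limit of the powers of \<open>1 - B\<^sup>*B\<close> for the rescaled operator
  serves.\<close>

lemma null_projection:
  assumes "B \<in> M"
  obtains E where "projection E" "\<And>x. E x = x \<longleftrightarrow> B x = 0" "\<And>x. B (E x) = 0"
proof -
  obtain K where K: "K > 0" "(\<lambda>x. (1 / K) *\<^sub>R B x) \<in> M" "\<And>x. norm ((1 / K) *\<^sub>R B x) \<le> norm x"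
    using ex_contraction_scaling[OF assms] by blast
  obtain E where "projection E" "\<forall>x. E x = x \<longleftrightarrow> (1 / K) *\<^sub>R B x = 0" "\<forall>x. (1 / K) *\<^sub>R B (E x) = 0"
    using contraction_powers_converge[OF K(2,3)] by blast
  then show ?thesis using that[of E] K(1) by auto
qed

text \<open>The quotient \<open>A/B\<close> of a majorised \<open>A\<close> is the strong limit of
  \<open>A (\<Sum>k<n. B\<^sup>* R\<^sup>k)\<close> with \<open>R = 1 - BB\<^sup>*\<close>, since
  \<open>B (\<Sum>k<n. B\<^sup>* R\<^sup>k) = 1 - R\<^sup>n\<close>.\<close>

lemma quotient_mem_contraction:
  assumes A: "A \<in> M" and B: "B \<in> M" and contr: "\<And>x. norm (B x) \<le> norm x"
    and le: "\<And>x. norm (A x) \<le> c * norm (B x)" and c: "c > 0"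
  shows "\<exists>W\<in>M. (\<forall>x. W (B x) = A x) \<and> (\<forall>x. adjoint B x = 0 \<longrightarrow> W x = 0)"
proof -
  have B': "adjoint B \<in> M" using B by (rule adjoint_mem)
  have contr': "norm (adjoint B x) \<le> norm x" for x
    using adjoint_norm_le[OF B, of 1] contr by simp
  define R where "R x = x - B (adjoint B x)" for x
  \<comment> \<open>The power limit is taken for \<open>adjoint B\<close> in place of
    \<open>B\<close>, so \<open>E\<close> projects onto the null space of \<open>adjoint B\<close>,
    the orthogonal complement of the range of \<open>B\<close>.\<close>
  obtain E where E: "projection E" "\<And>x. (\<lambda>n. (R ^^ n) x) \<longlonglongrightarrow> E x"
    "\<And>n x. norm ((R ^^ n) x) \<le> norm x" "\<And>x. adjoint B (E x) = 0"
    using contraction_powers_converge[OF B' contr', unfolded adjoint_adjoint[OF B]]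
    unfolding R_def [abs_def] by auto
  have R_apply: "R x = x - B (adjoint B x)" for x by (simp add: R_def)
  have R: "R \<in> M" unfolding R_def [abs_def] by (rule diff_mem[OF id_mem comp_mem[OF B B']])
  have Rn: "R ^^ n \<in> M" for n using R by (rule funpow_mem)
  define Z where "Z n x = (\<Sum>k<n. adjoint B ((R ^^ k) x))" for n x
  have Z: "Z n \<in> M" for n
    unfolding Z_def [abs_def] by (rule sum_mem[OF _ comp_mem[OF B' Rn]]) auto
  have BZ: "B (Z n x) = x - (R ^^ n) x" for n x
  proof (induction n)
    case (Suc n)
    have "B (Z (Suc n) x) = B (Z n x) + B (adjoint B ((R ^^ n) x))"
      by (simp add: Z_def mem_add[OF B])
    then show ?case using R_apply[of "(R ^^ n) x"] by (simp add: Suc)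
  qed (simp add: Z_def mem_zero[OF B])
  define W where "W x = lim (\<lambda>n. A (Z n x))" for x
  have lim: "(\<lambda>n. A (Z n x)) \<longlonglongrightarrow> W x" for x
  proof -
    \<comment> \<open>The majorisation carries the Cauchy property of
      \<open>B (Z n x) = x - (R ^^ n) x\<close> over to \<open>A (Z n x)\<close>; the vectors
      \<open>Z n x\<close> themselves need not converge.\<close>
    have "Cauchy (\<lambda>n. A (Z n x))"
    proof (rule metric_CauchyI)
      fix e :: real assume "0 < e"
      then have "0 < e / c" using c by simp
      then obtain N where N: "\<And>m n. m \<ge> N \<Longrightarrow> n \<ge> N \<Longrightarrow> dist ((R ^^ m) x) ((R ^^ n) x) < e / c"
        using LIMSEQ_imp_Cauchy[OF E(2)[of x]] unfolding Cauchy_def by metis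
      have "dist (A (Z m x)) (A (Z n x)) < e" if "m \<ge> N" "n \<ge> N" for m n
      proof -
        have "dist (A (Z m x)) (A (Z n x)) = norm (A (Z m x - Z n x))"
          by (simp add: dist_norm mem_diff[OF A])
        also have "\<dots> \<le> c * norm (B (Z m x - Z n x))" by (rule le)
        also have "\<dots> = c * dist ((R ^^ n) x) ((R ^^ m) x)"
          by (simp add: mem_diff[OF B] BZ dist_norm)
        also have "\<dots> < e" using N[of n m] that c by (simp add: field_simps)
        finally show ?thesis .
      qed
      then show "\<exists>N. \<forall>m\<ge>N. \<forall>n\<ge>N. dist (A (Z m x)) (A (Z n x)) < e" by blast
    qed
    then show ?thesis
      unfolding W_def using Cauchy_convergent convergent_LIMSEQ_iff by blast
  qed
  have "W \<in> M"
  proof (rule sequential_limit_mem[OF comp_mem[OF A Z] _ lim])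
    fix n x
    have "norm (x - (R ^^ n) x) \<le> 2 * norm x"
      using norm_triangle_ineq4[of x "(R ^^ n) x"] E(3)[of n x] by linarith
    then show "norm (A (Z n x)) \<le> (2 * c) * norm x"
      using le[of "Z n x"] c mult_left_mono[of "norm (x - (R ^^ n) x)" "2 * norm x" c]
      unfolding BZ by linarith
  qed
  moreover have "W (B x) = A x" for x
  proof -
    have "E (B x) \<bullet> E (B x) = B x \<bullet> E (B x)"
      using projection_inner[OF E(1)] projection_idem[OF E(1)] by metis
    also have "\<dots> = 0" by (simp add: inner_adjoint[OF B] E(4))
    finally have EB: "E (B x) = 0" by simp
    have "(\<lambda>n. A (Z n (B x)) - A x) \<longlonglongrightarrow> 0"
    proof (rule Lim_null_comparison)
      show "\<forall>\<^sub>F n in sequentially. norm (A (Z n (B x)) - A x) \<le> c * norm ((R ^^ n) (B x))"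
      proof (intro always_eventually allI)
        fix n
        have "norm (A (Z n (B x)) - A x) \<le> c * norm (B (Z n (B x) - x))"
          using le[of "Z n (B x) - x"] by (simp add: mem_diff[OF A])
        also have "B (Z n (B x) - x) = - (R ^^ n) (B x)" by (simp add: mem_diff[OF B] BZ)
        finally show "norm (A (Z n (B x)) - A x) \<le> c * norm ((R ^^ n) (B x))" by simp
      qed
      show "(\<lambda>n. c * norm ((R ^^ n) (B x))) \<longlonglongrightarrow> 0"
        using tendsto_mult_right_zero[OF tendsto_norm_zero, of "\<lambda>n. (R ^^ n) (B x)" sequentially c]
          E(2)[of "B x"] EB by simp
    qed
    then have "(\<lambda>n. A (Z n (B x))) \<longlonglongrightarrow> A x" by (simp add: LIM_zero_iff)
    then show ?thesis using lim LIMSEQ_unique by blast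
  qed
  moreover have "W x = 0" if x: "adjoint B x = 0" for x
  proof -
    have "(R ^^ n) x = x" for n 
      by (induction n) (simp_all add: R_apply[of x] x mem_zero[OF B])
    then have "Z n x = 0" for n by (simp add: Z_def x)
    then show ?thesis using lim[of x] by (simp add: LIMSEQ_const_iff mem_zero[OF A])
  qed
  ultimately show ?thesis by blast
qed

text \<open>This is Douglas' lemma in the form \<open>A = W B\<close>. Vanishing on the orthogonal
  complement of the range of \<open>B\<close> pins the continuous operator \<open>W\<close> down
  completely.\<close>

lemma quotient_mem:
  assumes A: "A \<in> M" and B: "B \<in> M" and le: "\<And>x. norm (A x) \<le> c * norm (B x)"
  obtains W where "W \<in> M" "\<And>x. W (B x) = A x" "\<And>x. adjoint B x = 0 \<Longrightarrow> W x = 0"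
proof -
  obtain K where K: "K > 0" "(\<lambda>x. (1 / K) *\<^sub>R B x) \<in> M" "\<And>x. norm ((1 / K) *\<^sub>R B x) \<le> norm x"
    using ex_contraction_scaling[OF B] by blast
  \<comment> \<open>The sign of \<open>c\<close> is unknown and the contraction version asks for a
    positive constant; hence \<open>\<bar>c\<bar> + 1\<close>.\<close>
  have "norm (A x) \<le> (K * (\<bar>c\<bar> + 1)) * norm ((1 / K) *\<^sub>R B x)" for x
  proof -
    have "norm (A x) \<le> (\<bar>c\<bar> + 1) * norm (B x)"
      by (rule order_trans[OF le]) (intro mult_right_mono, auto)
    then show ?thesis using K(1) by simp
  qed
  moreover have "K * (\<bar>c\<bar> + 1) > 0" using K(1) by (simp add: add_nonneg_pos)
  moreover have adj: "adjoint (\<lambda>x. (1 / K) *\<^sub>R B x) = (\<lambda>x. (1 / K) *\<^sub>R adjoint B x)"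
    by (rule adjoint_unique) (simp add: inner_adjoint[OF B])
  ultimately obtain W where "W \<in> M" "\<forall>x. W ((1 / K) *\<^sub>R B x) = A x"
      "\<forall>x. (1 / K) *\<^sub>R adjoint B x = 0 \<longrightarrow> W x = 0"
    using quotient_mem_contraction[OF A K(2,3), of "K * (\<bar>c\<bar> + 1)"] unfolding adj by blast
  then show ?thesis
    by (intro that[of "\<lambda>x. (1 / K) *\<^sub>R W x"] scaleR_mem) (use mem_scaleR in auto)
qed

section \<open>Polar decomposition\<close>

text \<open>Comparison with \<open>T 0\<close> supplies the common bound \<open>d 0 + K\<close>
  under which the algebra contains its strong limits.\<close>

lemma norm_limit_mem:
  assumes T: "\<And>n::nat. T n \<in> M" and Cauchy: "\<And>m n x. m \<le> n \<Longrightarrow> norm (T n x - T m x) \<le> d m * norm x"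
    and d: "d \<longlonglongrightarrow> 0"
  obtains L where "L \<in> M" "\<And>x. (\<lambda>n. T n x) \<longlonglongrightarrow> L x"
proof -
  have "convergent (\<lambda>n. T n x)" for x
  proof (rule Cauchy_convergent, rule metric_CauchyI)
    fix e :: real assume e: "0 < e"
    have "(\<lambda>n. d n * norm x) \<longlonglongrightarrow> 0" using d by (rule tendsto_mult_left_zero)
    then have "\<forall>\<^sub>F n in sequentially. d n * norm x < e / 2"
      using e by (intro order_tendstoD) auto
    then obtain N where N: "d N * norm x < e / 2" by (auto simp: eventually_sequentially)
    have near: "dist (T n x) (T N x) < e / 2" if "n \<ge> N" for n
      using Cauchy[OF that, of x] N by (simp add: dist_norm)
    have "dist (T m x) (T n x) < e" if "m \<ge> N" "n \<ge> N" for m n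
      using near[OF that(1)] near[OF that(2)] dist_triangle_half_l by blast
    then show "\<exists>N. \<forall>m\<ge>N. \<forall>n\<ge>N. dist (T m x) (T n x) < e" by blast
  qed
  then have lim: "(\<lambda>n. T n x) \<longlonglongrightarrow> lim (\<lambda>n. T n x)" for x
    by (simp add: convergent_LIMSEQ_iff)
  obtain K where K: "K > 0" "\<And>x. norm (T 0 x) \<le> norm x * K"
    using bounded_linear.pos_bounded[OF bounded_linear_mem[OF T]] by blast
  have "norm (T n x) \<le> (d 0 + K) * norm x" for n x
  proof -
    have "norm (T n x) \<le> norm (T n x - T 0 x) + norm (T 0 x)"
      using norm_triangle_ineq[of "T n x - T 0 x" "T 0 x"] by simp
    also have "\<dots> \<le> d 0 * norm x + norm x * K"
      by (intro add_mono Cauchy K) simp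
    finally show ?thesis by (simp add: algebra_simps)
  qed
  then have "(\<lambda>x. lim (\<lambda>n. T n x)) \<in> M"
    using lim by (rule sequential_limit_mem[OF T])
  then show ?thesis using that lim by blast
qed

text \<open>If \<open>0 \<le> H \<le> 1\<close> then \<open>1 - Y\<close> is a square root of \<open>H = 1 - R\<close> as soon as
  \<open>2Y = R + Y\<^sup>2\<close>; the iteration for \<open>Y\<close> is dominated by the scalar one for \<open>R = 1\<close>.\<close>

fun sqrt_iterate :: "('a \<Rightarrow> 'a) \<Rightarrow> nat \<Rightarrow> 'a \<Rightarrow> 'a" where
  "sqrt_iterate R 0 x = 0"
| "sqrt_iterate R (Suc n) x = (1 / 2) *\<^sub>R (R x + sqrt_iterate R n (sqrt_iterate R n x))"

fun sqrt_bound :: "nat \<Rightarrow> real" where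
  "sqrt_bound 0 = 0"
| "sqrt_bound (Suc n) = (1 + (sqrt_bound n)\<^sup>2) / 2"

lemma sqrt_bound_range: "0 \<le> sqrt_bound n" "sqrt_bound n \<le> 1"
proof -
  have "0 \<le> sqrt_bound n \<and> sqrt_bound n \<le> 1"
  proof (induction n)
    case (Suc n)
    then have "(sqrt_bound n)\<^sup>2 \<le> 1" by (simp add: power_le_one)
    then show ?case by simp
  qed simp
  then show "0 \<le> sqrt_bound n" "sqrt_bound n \<le> 1" by auto
qed

text \<open>The increment from \<open>sqrt_bound n\<close> to its successor is half the square of
  \<open>sqrt_bound n - 1\<close>.\<close>

lemma sqrt_bound_mono: "incseq sqrt_bound"
proof (rule incseq_SucI)
  show "sqrt_bound n \<le> sqrt_bound (Suc n)" for n
    using zero_le_power2[of "sqrt_bound n - 1"] by (simp add: power2_eq_square algebra_simps)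
qed

text \<open>Since the iterates commute, differences of their squares factor, so their increments are
  dominated by those of \<open>sqrt_bound\<close>, which is increasing and bounded. The limit
  \<open>Z\<close> is a fixed point of the iteration, and \<open>1 - Z\<close> is the root.\<close>

lemma ex_sqrt:
  assumes H: "H \<in> M" and H_inner: "\<And>x y. H x \<bullet> y = x \<bullet> H y"
    and contr: "\<And>x. norm (x - H x) \<le> norm x"
  obtains S where "S \<in> M" "\<And>x y. S x \<bullet> y = x \<bullet> S y" "\<And>x. S (S x) = H x"
proof -
  define R where "R x = x - H x" for x
  have R: "R \<in> M" unfolding R_def [abs_def] by (rule diff_mem[OF id_mem H])
  let ?Y = "sqrt_iterate R"
  let ?y = sqrt_bound
  have Y: "?Y n \<in> M" for n
  proof (induction n)
    case 0
    have "?Y 0 = (\<lambda>x. 0)" by (rule ext) simp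
    then show ?case using zero_mem by simp
  next
    case (Suc n)
    have "?Y (Suc n) = (\<lambda>x. (1 / 2) *\<^sub>R (R x + ?Y n (?Y n x)))" by (rule ext) simp
    then show ?case using scaleR_mem[OF add_mem[OF R comp_mem[OF Suc Suc]], of "1 / 2"] by simp
  qed
  \<comment> \<open>Applied first to \<open>R\<close> and then to an iterate, this makes all
    iterates commute with one another.\<close>
  have commute: "?Y n (S x) = S (?Y n x)" if S: "S \<in> M" "\<And>x. R (S x) = S (R x)" for S n x
    by (induction n arbitrary: x)
      (simp_all add: mem_zero[OF S(1)] mem_add[OF S(1)] mem_scaleR[OF S(1)] S(2))
  have YY: "?Y m (?Y n x) = ?Y n (?Y m x)" for m n x
    by (rule commute[OF Y]) (rule commute[OF R refl, symmetric])
  have norm_Y: "norm (?Y n x) \<le> ?y n * norm x" for n x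
  proof (induction n arbitrary: x)
    case (Suc n)
    have "norm (?Y n (?Y n x)) \<le> ?y n * norm (?Y n x)" by (rule Suc)
    also have "\<dots> \<le> ?y n * (?y n * norm x)"
      by (intro mult_left_mono Suc sqrt_bound_range)
    finally have "norm (R x + ?Y n (?Y n x)) \<le> norm x + ?y n * (?y n * norm x)"
      using contr[of x] by (intro norm_triangle_le add_mono) (simp_all add: R_def)
    then show ?case
      by (simp only: sqrt_iterate.simps norm_scaleR sqrt_bound.simps)
        (simp add: field_simps power2_eq_square)
  qed simp
  have norm_diff: "norm (?Y (Suc n) x - ?Y n x) \<le> (?y (Suc n) - ?y n) * norm x" for n x
  proof (induction n arbitrary: x)
    case 0
    show ?case using norm_Y[of 1 x] by simp
  next
    case (Suc n)
    define z where "z = ?Y (Suc n) x - ?Y n x"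
    have "?Y (Suc (Suc n)) x - ?Y (Suc n) x =
        (1 / 2) *\<^sub>R (?Y (Suc n) (?Y (Suc n) x) - ?Y n (?Y n x))"
      by (simp only: sqrt_iterate.simps(2)[of R "Suc n"]) (simp add: scaleR_diff_right algebra_simps)
    \<comment> \<open>The cross terms cancel by \<open>YY\<close>.\<close>
    also have "?Y (Suc n) (?Y (Suc n) x) - ?Y n (?Y n x) = ?Y (Suc n) z + ?Y n z"
      unfolding z_def using YY[of "Suc n" n x]
      by (simp only: mem_diff[OF Y]) simp
    finally have "norm (?Y (Suc (Suc n)) x - ?Y (Suc n) x) = norm (?Y (Suc n) z + ?Y n z) / 2"
      by simp
    also have "\<dots> \<le> (?y (Suc n) * norm z + ?y n * norm z) / 2"
      by (intro divide_right_mono norm_triangle_le add_mono norm_Y) simp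
    also have "\<dots> = (?y (Suc n) + ?y n) / 2 * norm z" by (simp add: field_simps del: sqrt_bound.simps)
    also have "\<dots> \<le> (?y (Suc n) + ?y n) / 2 * ((?y (Suc n) - ?y n) * norm x)"
      unfolding z_def using sqrt_bound_range(1) by (intro mult_left_mono Suc) simp
    also have "\<dots> = (?y (Suc (Suc n)) - ?y (Suc n)) * norm x"
      by (simp only: sqrt_bound.simps(2)[of "Suc n"] sqrt_bound.simps(2)[of n])
        (simp add: power2_eq_square field_simps)
    finally show ?case .
  qed
  have norm_diff': "norm (?Y n x - ?Y m x) \<le> (?y n - ?y m) * norm x" if "m \<le> n" for m n x
    using that
  proof (induction n rule: dec_induct)
    case (step n)
    have "norm (?Y (Suc n) x - ?Y m x) \<le> norm (?Y (Suc n) x - ?Y n x) + norm (?Y n x - ?Y m x)"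
      using norm_triangle_ineq[of "?Y (Suc n) x - ?Y n x" "?Y n x - ?Y m x"] by simp
    also have "\<dots> \<le> (?y (Suc n) - ?y n) * norm x + (?y n - ?y m) * norm x"
      by (intro add_mono norm_diff step)
    finally show ?case by (simp add: algebra_simps)
  qed simp
  obtain l where l: "?y \<longlonglongrightarrow> l" "\<And>n. ?y n \<le> l"
    using incseq_convergent[OF sqrt_bound_mono] sqrt_bound_range(2) by metis
  obtain Z where Z: "Z \<in> M" "\<And>x. (\<lambda>n. ?Y n x) \<longlonglongrightarrow> Z x"
  proof (rule norm_limit_mem[OF Y])
    show "norm (?Y n x - ?Y m x) \<le> (l - ?y m) * norm x" if "m \<le> n" for m n x
      using norm_diff'[OF that, of x] mult_right_mono[of "?y n - ?y m" "l - ?y m" "norm x"] l(2)[of n]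
      by simp
    show "(\<lambda>m. l - ?y m) \<longlonglongrightarrow> 0"
      using tendsto_diff[OF tendsto_const l(1), of l] by simp
  qed blast
  \<comment> \<open>The product converges although both factors vary, because the outer factor has
    norm at most one for every \<open>n\<close>.\<close>
  have ZZ: "(\<lambda>n. ?Y n (?Y n x)) \<longlonglongrightarrow> Z (Z x)" for x
  proof -
    have "(\<lambda>n. ?Y n (?Y n x - Z x)) \<longlonglongrightarrow> 0"
    proof (rule Lim_null_comparison)
      have "norm (?Y n (?Y n x - Z x)) \<le> norm (?Y n x - Z x)" for n
        using norm_Y[of n "?Y n x - Z x"] mult_right_mono[OF sqrt_bound_range(2)[of n], of "norm (?Y n x - Z x)"]
        by simp
      then show "\<forall>\<^sub>F n in sequentially. norm (?Y n (?Y n x - Z x)) \<le> norm (?Y n x - Z x)" by simp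
      show "(\<lambda>n. norm (?Y n x - Z x)) \<longlonglongrightarrow> 0"
        using Z(2)[of x] by (intro tendsto_norm_zero LIM_zero)
    qed
    then have "(\<lambda>n. ?Y n (?Y n x - Z x) + ?Y n (Z x)) \<longlonglongrightarrow> 0 + Z (Z x)"
      by (intro tendsto_add Z)
    then show ?thesis by (simp add: mem_diff[OF Y])
  qed
  have Z_eq: "Z x = (1 / 2) *\<^sub>R (R x + Z (Z x))" for x
  proof (rule LIMSEQ_unique)
    show "(\<lambda>n. ?Y (Suc n) x) \<longlonglongrightarrow> Z x" using Z(2)[of x] by (rule LIMSEQ_Suc)
    show "(\<lambda>n. ?Y (Suc n) x) \<longlonglongrightarrow> (1 / 2) *\<^sub>R (R x + Z (Z x))"
      by (simp only: sqrt_iterate.simps) (intro tendsto_intros ZZ)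
  qed
  have Y_inner: "?Y n x \<bullet> y = x \<bullet> ?Y n y" for n x y
    by (induction n arbitrary: x y) (simp_all add: inner_add R_def H_inner inner_diff)
  have Z_inner: "Z x \<bullet> y = x \<bullet> Z y" for x y
  proof (rule LIMSEQ_unique)
    show "(\<lambda>n. ?Y n x \<bullet> y) \<longlonglongrightarrow> Z x \<bullet> y" by (intro tendsto_intros Z)
    show "(\<lambda>n. ?Y n x \<bullet> y) \<longlonglongrightarrow> x \<bullet> Z y" unfolding Y_inner by (intro tendsto_intros Z)
  qed
  show ?thesis
  proof (rule that)
    show "(\<lambda>x. x - Z x) \<in> M" by (rule diff_mem[OF id_mem Z(1)])
    show "(x - Z x) \<bullet> y = x \<bullet> (y - Z y)" for x y by (simp add: inner_diff Z_inner)
    show "(x - Z x) - Z (x - Z x) = H x" for x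
    proof -
      have "R x = 2 *\<^sub>R Z x - Z (Z x)"
        using arg_cong[OF Z_eq[of x], of "\<lambda>v. 2 *\<^sub>R v"] by simp
      then show ?thesis by (simp add: R_def mem_diff[OF Z(1)] scaleR_2 algebra_simps)
    qed
  qed
qed

section \<open>Partial isometries\<close>

text \<open>The identity \<open>W W\<^sup>* W = W\<close> makes \<open>W\<^sup>* W\<close> and
  \<open>W W\<^sup>*\<close> the projections onto the initial and the final space, without
  mentioning either space.\<close>

definition partial_isometry :: "('a \<Rightarrow> 'a) \<Rightarrow> bool" where
  "partial_isometry W \<longleftrightarrow> W \<in> M \<and> (\<forall>x. W (adjoint W (W x)) = W x)"

lemma partial_isometry_mem: "partial_isometry W \<Longrightarrow> W \<in> M"
  and partial_isometry_eq: "partial_isometry W \<Longrightarrow> W (adjoint W (W x)) = W x"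
  by (auto simp: partial_isometry_def)

lemma partial_isometry_adjoint_eq:
  assumes "partial_isometry W"
  shows "adjoint W (W (adjoint W y)) = adjoint W y"
proof (rule vector_eq_rdot[THEN iffD1], intro allI)
  fix x
  have W: "W \<in> M" using assms by (rule partial_isometry_mem)
  show "adjoint W (W (adjoint W y)) \<bullet> x = adjoint W y \<bullet> x"
    by (simp add: adjoint_inner[OF W] inner_adjoint[OF W, of _ "W x"] partial_isometry_eq[OF assms])
qed

lemma partial_isometry_initial: "partial_isometry W \<Longrightarrow> projection (\<lambda>x. adjoint W (W x))"
  unfolding projection_def
  by (auto intro: comp_mem adjoint_mem partial_isometry_mem
      simp: partial_isometry_eq adjoint_inner inner_adjoint[of W _ "W _"] partial_isometry_mem)

lemma norm_projection_le: "projection P \<Longrightarrow> norm (P x) \<le> norm x"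
proof -
  assume P: "projection P"
  have "norm (P x) * norm (P x) = P x \<bullet> x"
    using P by (metis power2_eq_square power2_norm_eq_inner projection_idem projection_inner)
  also have "\<dots> \<le> norm (P x) * norm x" by (rule norm_cauchy_schwarz)
  finally show ?thesis by (cases "norm (P x) = 0") auto
qed

lemma norm_adjoint_partial_isometry: "partial_isometry W \<Longrightarrow> norm (adjoint W (W x)) = norm (W x)"
proof -
  assume W: "partial_isometry W"
  have "(norm (adjoint W (W x)))\<^sup>2 = (norm (W x))\<^sup>2"
    by (simp add: adjoint_inner[OF partial_isometry_mem[OF W]] partial_isometry_eq[OF W] power2_norm_eq_inner)
  then show ?thesis by (simp add: power2_eq_iff_nonneg)
qed

lemma norm_partial_isometry_le: "partial_isometry W \<Longrightarrow> norm (W x) \<le> norm x"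
  using norm_projection_le[OF partial_isometry_initial, of W x] norm_adjoint_partial_isometry[of W x]
  by simp

text \<open>\<open>W\<^sup>* W\<close> is a projection with
  \<open>norm (adjoint W (W p)) = norm (W p)\<close>, and a projection that preserves the length of
  a vector fixes it.\<close>

lemma partial_isometry_initial_iff:
  assumes "partial_isometry W"
  shows "adjoint W (W p) = p \<longleftrightarrow> norm (W p) = norm p"
proof
  note W = partial_isometry_mem[OF assms]
  assume "norm (W p) = norm p"
  then have "(norm (adjoint W (W p) - p))\<^sup>2 = 0"
    using norm_adjoint_partial_isometry[OF assms, of p]
    by (simp add: power2_norm_eq_inner inner_diff adjoint_inner[OF W] inner_adjoint[OF W, symmetric]
        mem_diff[OF W] partial_isometry_eq[OF assms] norm_eq)
  then show "adjoint W (W p) = p" by simp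
qed (metis norm_adjoint_partial_isometry[OF assms])

text \<open>\<open>S\<close> is the absolute value of the rescaled operator \<open>A\<close>, and
  \<open>U\<close> is the quotient of \<open>A\<close> by \<open>S\<close>, extended by zero. The
  conclusion records what the maximality argument consumes: \<open>U\<close> is nonzero, and
  \<open>U\<close> and its adjoint vanish where \<open>T\<close> and its adjoint do.\<close>

lemma polar_decomposition:
  assumes T: "T \<in> M" and nz: "T x0 \<noteq> 0"
  obtains U x1 where "partial_isometry U" "U x1 \<noteq> 0" "\<And>x. T x = 0 \<Longrightarrow> U x = 0"
    "\<And>y. adjoint T y = 0 \<Longrightarrow> adjoint U y = 0"
proof -
  obtain K where K: "K > 0" "(\<lambda>x. (1 / K) *\<^sub>R T x) \<in> M" "\<And>x. norm ((1 / K) *\<^sub>R T x) \<le> norm x"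
    using ex_contraction_scaling[OF T] by blast
  define A where "A x = (1 / K) *\<^sub>R T x" for x
  have A: "A \<in> M" and contr: "norm (A x) \<le> norm x" for x
    using K by (auto simp: A_def [abs_def])
  have adjA: "adjoint A = (\<lambda>y. (1 / K) *\<^sub>R adjoint T y)"
    by (rule adjoint_unique) (simp add: A_def inner_adjoint[OF T])
  have A': "adjoint A \<in> M" using A by (rule adjoint_mem)
  \<comment> \<open>This is the case \<open>n = 1\<close> of the bound on the powers of
    \<open>1 - A\<^sup>*A\<close>.\<close>
  have contr': "norm (x - adjoint A (A x)) \<le> norm x" for x
  proof -
    have "\<forall>n x. norm (((\<lambda>x. x - adjoint A (A x)) ^^ n) x) \<le> norm x"
      using contraction_powers_converge[OF A contr] by blast
    then show ?thesis by (metis (no_types, lifting) comp_apply funpow_0 funpow.simps(2))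
  qed
  obtain S where S: "S \<in> M" "\<And>x y. S x \<bullet> y = x \<bullet> S y" "\<And>x. S (S x) = adjoint A (A x)"
    using ex_sqrt[OF comp_mem[OF A' A] _ contr']
    by (metis adjoint_inner[OF A] inner_adjoint[OF A])
  have adjS: "adjoint S = S" by (rule adjoint_unique) (simp add: S)
  have SA: "S x \<bullet> S y = A x \<bullet> A y" for x y
    by (simp add: S(2)[of x] S(3) inner_adjoint[OF A])
  have S0: "S x = 0 \<longleftrightarrow> A x = 0" for x
    using SA[of x x] by (metis inner_eq_zero_iff)
  have "norm (A x) \<le> 1 * norm (S x)" for x
    using SA[of x x] by (simp add: norm_eq_sqrt_inner)
  then obtain U where U: "U \<in> M" "\<And>x. U (S x) = A x" "\<And>x. S x = 0 \<Longrightarrow> U x = 0"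
    using quotient_mem[OF A S(1)] adjS by metis
  have U': "adjoint U \<in> M" using U(1) by (rule adjoint_mem)
  have SUU: "S (adjoint U (U (S x))) = S (S x)" for x
    by (rule vector_eq_rdot[THEN iffD1], intro allI)
      (simp add: S(2)[of "adjoint U _"] adjoint_inner[OF U(1)] U(2) SA S(2)[of "S x"] flip: SA)
  \<comment> \<open>The values of \<open>U\<^sup>* U S - S\<close> lie in the null space of
    \<open>S\<close>, where \<open>U\<close> vanishes.\<close>
  have UUS: "U (adjoint U (U (S x))) = U (S x)" for x
  proof -
    have "S (adjoint U (U (S x)) - S x) = 0" by (simp add: mem_diff[OF S(1)] SUU)
    then have "U (adjoint U (U (S x)) - S x) = 0" by (rule U(3))
    then show ?thesis by (simp add: mem_diff[OF U(1)])
  qed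
  have "partial_isometry U"
    unfolding partial_isometry_def
  proof (intro conjI allI U(1))
    fix x
    \<comment> \<open>\<open>?X\<close> vanishes on the range of \<open>S\<close> and on the null
      space of \<open>S\<close>, its orthogonal complement. Algebraically, \<open>X S = 0\<close>
      gives \<open>S X\<^sup>* = 0\<close>, then \<open>X X\<^sup>* = 0\<close>, and so
      \<open>X = 0\<close>.\<close>
    let ?X = "\<lambda>x. U (adjoint U (U x)) - U x"
    have X: "?X \<in> M" by (rule diff_mem[OF comp_mem[OF U(1) comp_mem[OF U' U(1)]] U(1)])
    have X0: "?X v = 0" if "S v = 0" for v
      using U(3)[OF that] by (simp add: mem_zero[OF U(1)] mem_zero[OF U'])
    have "S (adjoint ?X y) = 0" for y
    proof -
      have "S (adjoint ?X y) \<bullet> z = 0" for z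
        using adjoint_inner[OF X, of y "S z"] UUS by (simp add: S(2))
      then show ?thesis by (metis inner_eq_zero_iff)
    qed
    then have "?X (adjoint ?X y) = 0" for y by (rule X0)
    then have "adjoint ?X y = 0" for y
      using adjoint_inner[OF X, of y "adjoint ?X y"] by simp
    then have "?X x = 0"
      using inner_adjoint[OF X, of x "?X x"] by simp
    then show "U (adjoint U (U x)) = U x" by simp
  qed
  moreover have "U (S x0) \<noteq> 0" using nz K(1) by (simp add: U(2) A_def)
  moreover have "U x = 0" if "T x = 0" for x
    by (rule U(3)) (simp add: S0 A_def that)
  moreover have "adjoint U y = 0" if "adjoint T y = 0" for y
  proof -
    \<comment> \<open>\<open>S U\<^sup>* = A\<^sup>*\<close>, so \<open>adjoint U y\<close> lies in
      the null space of \<open>S\<close> and is killed by \<open>U\<close>.\<close>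
    have "S (adjoint U y) \<bullet> z = 0" for z
    proof -
      have "S (adjoint U y) \<bullet> z = y \<bullet> A z" by (simp add: S(2) adjoint_inner[OF U(1)] U(2))
      also have "\<dots> = adjoint A y \<bullet> z" by (simp add: adjoint_inner[OF A])
      also have "\<dots> = 0" by (simp add: adjA that)
      finally show ?thesis .
    qed
    then have "U (adjoint U y) = 0" using U(3) by (metis inner_eq_zero_iff)
    then show ?thesis using adjoint_inner[OF U(1), of y "adjoint U y"] by simp
  qed
  ultimately show ?thesis by (rule that)
qed

section \<open>Comparison of projections\<close>

text \<open>The inner product condition makes \<open>(norm (U x - S x))\<^sup>2\<close> equal to
  \<open>(norm (U x))\<^sup>2 - (norm (S x))\<^sup>2\<close> for \<open>S\<close> below \<open>U\<close>, so that the net is Cauchy at every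
  point.\<close>

lemma directed_limit:
  assumes D: "D \<subseteq> M" "D \<noteq> {}" and norm_le: "\<And>T x. T \<in> D \<Longrightarrow> norm (T x) \<le> norm x"
    and directed: "\<And>S T. S \<in> D \<Longrightarrow> T \<in> D \<Longrightarrow> \<exists>U\<in>D. le S U \<and> le T U"
    and le_trans: "\<And>S T U. S \<in> D \<Longrightarrow> T \<in> D \<Longrightarrow> U \<in> D \<Longrightarrow> le S T \<Longrightarrow> le T U \<Longrightarrow> le S U"
    and inner: "\<And>S U x y. S \<in> D \<Longrightarrow> U \<in> D \<Longrightarrow> le S U \<Longrightarrow> S x \<bullet> U y = S x \<bullet> S y"
  obtains F L where "F \<noteq> bot" "\<forall>\<^sub>F T in F. T \<in> D" "\<And>S. S \<in> D \<Longrightarrow> \<forall>\<^sub>F T in F. le S T"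
    "L \<in> M" "\<And>x. ((\<lambda>T. T x) \<longlongrightarrow> L x) F"
proof -
  \<comment> \<open>Directedness makes the sets \<open>{U \<in> D. le S U}\<close> a base of this
    filter.\<close>
  define F where "F = (INF S\<in>D. principal {U \<in> D. le S U})"
  have ev: "eventually P F \<longleftrightarrow> (\<exists>S\<in>D. \<forall>U\<in>D. le S U \<longrightarrow> P U)" for P
    unfolding F_def
  proof (subst eventually_INF_base)
    fix S T assume ST: "S \<in> D" "T \<in> D"
    then obtain U where "U \<in> D" "le S U" "le T U" using directed by blast
    then have "{V \<in> D. le U V} \<subseteq> {V \<in> D. le S V} \<inter> {V \<in> D. le T V}"
      using le_trans ST by blast
    then show "\<exists>x\<in>D. principal {U \<in> D. le x U} \<le>
        inf (principal {U \<in> D. le S U}) (principal {U \<in> D. le T U})"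
      using \<open>U \<in> D\<close> by auto
  qed (use D in \<open>auto simp: eventually_principal\<close>)
  have nb: "F \<noteq> bot"
    unfolding trivial_limit_def ev using directed by blast
  have in_D: "\<forall>\<^sub>F T in F. T \<in> D" using D ev by blast
  have ev_le: "\<forall>\<^sub>F T in F. le S T" if "S \<in> D" for S using that ev by blast
  have "\<exists>l. ((\<lambda>T. T x) \<longlongrightarrow> l) F" for x
  proof -
    \<comment> \<open>\<open>S\<close> will be chosen with \<open>(norm (S x))\<^sup>2\<close>
      within \<open>(e / 2)\<^sup>2\<close> of the supremum \<open>s\<close>, so operators above
      \<open>S\<close> hardly move at \<open>x\<close>.\<close>
    define s where "s = (SUP T\<in>D. (norm (T x))\<^sup>2)"
    have bdd: "bdd_above ((\<lambda>T. (norm (T x))\<^sup>2) ` D)"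
      using norm_le by (intro bdd_aboveI2[of _ _ "(norm x)\<^sup>2"] power_mono) auto
    have "cauchy_filter (filtermap (\<lambda>T. T x) F)"
      unfolding cauchy_filter_metric_filtermap
    proof (intro allI impI)
      fix e :: real assume e: "0 < e"
      then have "s - (e / 2)\<^sup>2 < s" by simp
      then obtain S where S: "S \<in> D" "s - (e / 2)\<^sup>2 < (norm (S x))\<^sup>2"
        unfolding s_def using less_cSUP_iff[OF D(2) bdd] by blast
      have near: "dist (U x) (S x) < e / 2" if "U \<in> D" "le S U" for U
      proof -
        have "S x \<bullet> U x = S x \<bullet> S x" using inner[OF S(1) that] .
        then have "(dist (U x) (S x))\<^sup>2 = (norm (U x))\<^sup>2 - (norm (S x))\<^sup>2"
          by (simp add: dist_norm power2_norm_eq_inner inner_diff inner_commute)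
        also have "\<dots> < (e / 2)\<^sup>2"
          using S(2) cSUP_upper[OF that(1) bdd] unfolding s_def by simp
        finally show ?thesis by (rule power_less_imp_less_base) (use e in simp)
      qed
      show "\<exists>P. eventually P F \<and> (\<forall>U V. P U \<and> P V \<longrightarrow> dist (U x) (V x) < e)"
      proof (intro exI[of _ "\<lambda>U. U \<in> D \<and> le S U"] conjI allI impI)
        show "\<forall>\<^sub>F U in F. U \<in> D \<and> le S U" using in_D ev_le[OF S(1)] by (rule eventually_conj)
        show "dist (U x) (V x) < e" if "(U \<in> D \<and> le S U) \<and> V \<in> D \<and> le S V" for U V
          using near that dist_triangle_half_l by blast
      qed
    qed
    then have "\<exists>l. filtermap (\<lambda>T. T x) F \<le> nhds l"
      by (rule cauchy_filter_complete_converges[of _ UNIV])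
        (auto simp: complete_UNIV nb filtermap_bot_iff)
    then show ?thesis by (simp add: filterlim_def)
  qed
  then obtain L where L: "\<And>x. ((\<lambda>T. T x) \<longlongrightarrow> L x) F" by metis
  have "L \<in> M"
  proof (rule limit_mem[OF nb _ _ L])
    show "\<forall>\<^sub>F T in F. T \<in> M" using in_D by eventually_elim (use D in auto)
    show "\<forall>\<^sub>F T in F. \<forall>x. norm (T x) \<le> 1 * norm x"
      using in_D by eventually_elim (use norm_le in auto)
  qed
  with nb in_D ev_le show ?thesis using L by (rule that)
qed

lemma support_projection:
  assumes "B \<in> M"
  obtains R where "projection R" "\<And>x. R x = 0 \<longleftrightarrow> B x = 0" "\<And>x. B (R x) = B x"
proof -
  obtain E where E: "projection E" "\<And>x. E x = x \<longleftrightarrow> B x = 0" "\<And>x. B (E x) = 0"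
    using null_projection[OF assms] by blast
  show ?thesis
  proof (rule that[OF projection_complement[OF E(1)]])
    show "x - E x = 0 \<longleftrightarrow> B x = 0" for x using E(2)[of x] by auto
    show "B (x - E x) = B x" for x by (simp add: mem_diff[OF assms] E(3))
  qed
qed

text \<open>\<open>Q\<close> is the strong limit of the directed set \<open>D\<close> of projections
  vanishing on the common null space. Two of them are dominated by the support of their sum, because
  the null space of a sum of positive operators is the intersection of their null spaces.\<close>

lemma joint_support_projection:
  assumes "\<S> \<subseteq> M"
  obtains Q where "projection Q" "\<And>x. Q x = 0 \<longleftrightarrow> (\<forall>S\<in>\<S>. S x = 0)"
proof -
  define D where "D = {R. projection R \<and> (\<forall>x. (\<forall>S\<in>\<S>. S x = 0) \<longrightarrow> R x = 0)}"
  \<comment> \<open>For projections, \<open>R U = R\<close> is the order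
    \<open>R \<le> U\<close>.\<close>
  let ?le = "\<lambda>R U. \<forall>x. R (U x) = R x"
  have proj: "projection R" if "R \<in> D" for R using that by (simp add: D_def)
  have DM: "D \<subseteq> M" using proj projection_mem by blast
  have "(\<lambda>x. 0) \<in> D" by (simp add: D_def projection_def zero_mem)
  then have ne: "D \<noteq> {}" by blast
  have directed: "\<exists>U\<in>D. ?le R U \<and> ?le T U" if RT: "R \<in> D" "T \<in> D" for R T
  proof -
    have RM: "R \<in> M" and TM: "T \<in> M" using DM RT by auto
    obtain U where U: "projection U" "\<And>x. U x = 0 \<longleftrightarrow> R x + T x = 0"
      using support_projection[OF add_mem[OF RM TM]] by metis
    have null: "R x = 0 \<and> T x = 0" if "U x = 0" for x
    proof -
      have "0 = (R x + T x) \<bullet> x" using U(2)[of x] that by simp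
      also have "\<dots> = R x \<bullet> R x + T x \<bullet> T x"
        using projection_inner projection_idem proj RT by (metis inner_add_left)
      finally have "R x \<bullet> R x + T x \<bullet> T x = 0" by simp
      then show ?thesis by (metis add_nonneg_eq_0_iff inner_eq_zero_iff inner_ge_zero)
    qed
    have "U (x - U x) = 0" for x
      by (simp add: mem_diff[OF projection_mem[OF U(1)]] projection_idem[OF U(1)])
    then have "R (x - U x) = 0 \<and> T (x - U x) = 0" for x by (rule null)
    then have "?le R U \<and> ?le T U" by (simp add: mem_diff[OF RM] mem_diff[OF TM])
    moreover have "U \<in> D" using RT U by (auto simp: D_def)
    ultimately show ?thesis by blast
  qed
  obtain F Q where F: "F \<noteq> bot" "\<forall>\<^sub>F T in F. T \<in> D" "\<And>R. R \<in> D \<Longrightarrow> \<forall>\<^sub>F T in F. ?le R T"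
    and Q: "Q \<in> M" "\<And>x. ((\<lambda>T. T x) \<longlongrightarrow> Q x) F"
  proof (rule directed_limit[where le = ?le, OF DM ne _ directed])
    show "norm (T x) \<le> norm x" if "T \<in> D" for T x using norm_projection_le proj that by blast
    show "?le R U" if "?le R T" "?le T U" for R T U using that by metis
    show "R x \<bullet> U y = R x \<bullet> R y" if "R \<in> D" "U \<in> D" "?le R U" for R U x y
      using that projection_inner[OF proj] projection_idem[OF proj] by metis
  qed (assumption | rule that)+
  have RQ: "R (Q x) = R x" if R: "R \<in> D" for R x
  proof (rule tendsto_unique[OF F(1)])
    show "((\<lambda>T. R (T x)) \<longlongrightarrow> R (Q x)) F"
      by (rule mem_tendsto[OF _ Q(2)]) (use R DM in auto)
    show "((\<lambda>T. R (T x)) \<longlongrightarrow> R x) F"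
      by (rule tendsto_eventually) (use F(3)[OF R] in eventually_elim, auto)
  qed
  have "Q (Q x) = Q x" for x
  proof (rule tendsto_unique[OF F(1)])
    show "((\<lambda>T. T (Q x)) \<longlongrightarrow> Q (Q x)) F" by (rule Q)
    show "((\<lambda>T. T (Q x)) \<longlongrightarrow> Q x) F"
      by (rule Lim_transform_eventually[OF Q(2)[of x]])
        (use F(2) in eventually_elim, simp add: RQ)
  qed
  moreover have "Q x \<bullet> y = x \<bullet> Q y" for x y
  proof (rule tendsto_unique[OF F(1)])
    show "((\<lambda>T. T x \<bullet> y) \<longlongrightarrow> Q x \<bullet> y) F" by (intro tendsto_intros Q)
    have "((\<lambda>T. x \<bullet> T y) \<longlongrightarrow> x \<bullet> Q y) F" by (intro tendsto_intros Q)
    then show "((\<lambda>T. T x \<bullet> y) \<longlongrightarrow> x \<bullet> Q y) F"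
      by (rule Lim_transform_eventually)
        (use F(2) in eventually_elim, simp add: projection_inner[OF proj])
  qed
  ultimately have "projection Q" using Q(1) by (simp add: projection_def)
  moreover have "Q x = 0 \<longleftrightarrow> (\<forall>S\<in>\<S>. S x = 0)" for x
  proof
    assume Qx: "Q x = 0"
    show "\<forall>S\<in>\<S>. S x = 0"
    proof
      fix S assume S: "S \<in> \<S>"
      then obtain R where R: "projection R" "\<And>x. R x = 0 \<longleftrightarrow> S x = 0"
        using support_projection assms by blast
      then have "R \<in> D" using S by (auto simp: D_def)
      then have "R x = 0" using RQ[of R x] Qx mem_zero[of R] DM by auto
      then show "S x = 0" using R by blast
    qed
  next
    assume "\<forall>S\<in>\<S>. S x = 0"
    then have "R x = 0" if "R \<in> D" for R using that by (auto simp: D_def)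
    then have "((\<lambda>T. T x) \<longlongrightarrow> 0) F"
      by (intro tendsto_eventually) (use F(2) in eventually_elim, auto)
    then show "Q x = 0" using tendsto_unique[OF F(1) Q(2)] by blast
  qed
  ultimately show ?thesis by (rule that)
qed

section \<open>The extension order on partial isometries\<close>

text \<open>The vectors \<open>adjoint W (W x)\<close> fill the initial space of \<open>W\<close>,
  so \<open>U\<close> agrees with \<open>W\<close> there.\<close>

definition extends :: "('a \<Rightarrow> 'a) \<Rightarrow> ('a \<Rightarrow> 'a) \<Rightarrow> bool" where
  "extends W U \<longleftrightarrow> (\<forall>x. U (adjoint W (W x)) = W x)"

text \<open>\<open>U\<close> acts on the initial space of \<open>W\<close> as \<open>W\<close> does,
  hence isometrically, so the norm criterion puts that space inside the initial space of
  \<open>U\<close>.\<close>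

lemma extends_initial:
  assumes "partial_isometry W" "partial_isometry U" "extends W U"
  shows "adjoint U (U (adjoint W (W x))) = adjoint W (W x)"
  unfolding partial_isometry_initial_iff[OF assms(2)]
  using assms(3) norm_adjoint_partial_isometry[OF assms(1)] by (simp add: extends_def)

text \<open>Supplies the inner product condition of \<open>directed_limit\<close>:
  \<open>W x\<close> is the image under \<open>U\<close> of a vector that \<open>U\<^sup>* U\<close>
  fixes.\<close>

lemma extends_inner:
  assumes W: "partial_isometry W" and U: "partial_isometry U" and "extends W U"
  shows "W x \<bullet> U y = W x \<bullet> W y"
proof -
  have "W x \<bullet> U y = U (adjoint W (W x)) \<bullet> U y" using assms(3) by (simp add: extends_def)
  also have "\<dots> = adjoint U (U (adjoint W (W x))) \<bullet> y"
    by (simp add: adjoint_inner partial_isometry_mem[OF U])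
  also have "\<dots> = W x \<bullet> W y"
    by (simp add: extends_initial[OF assms] adjoint_inner partial_isometry_mem[OF W])
  finally show ?thesis .
qed

lemma extends_trans:
  assumes "partial_isometry W" "partial_isometry U" "extends W U" "extends U V"
  shows "extends W V"
  unfolding extends_def
  using extends_initial[OF assms(1-3)] assms(3,4) unfolding extends_def by metis

lemma extends_antisym:
  assumes W: "partial_isometry W" and U: "partial_isometry U" and "extends W U" "extends U W"
  shows "W = U"
proof
  fix x
  have "W x \<bullet> U x = W x \<bullet> W x" "U x \<bullet> W x = U x \<bullet> U x"
    using extends_inner assms by blast+
  then have "(W x - U x) \<bullet> (W x - U x) = 0" by (simp add: inner_diff inner_commute)
  then show "W x = U x" by simp
qed

text \<open>Zorn's lemma for \<open>extends\<close>; a nonempty chain is bounded by its strong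
  limit.\<close>

lemma maximal_partial_isometry:
  assumes E: "E \<in> M" and F: "F \<in> M"
  defines "A \<equiv> {W. partial_isometry W \<and> (\<forall>x. W (E x) = W x) \<and> (\<forall>x. F (W x) = W x)}"
  obtains W where "W \<in> A" "\<And>U. U \<in> A \<Longrightarrow> extends W U \<Longrightarrow> U = W"
proof -
  have pi: "partial_isometry W" if "W \<in> A" for W using that by (simp add: A_def)
  have "\<exists>m\<in>A. \<forall>a\<in>A. extends m a \<longrightarrow> a = m"
  proof (rule predicate_Zorn)
    show "partial_order_on A (relation_of extends A)"
      unfolding partial_order_on_def preorder_on_def
    proof (intro conjI)
      show "relation_of extends A \<subseteq> A \<times> A" by (auto simp: relation_of_def)
      show "refl_on A (relation_of extends A)"
        by (auto simp: refl_on_def relation_of_def extends_def partial_isometry_eq pi)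
      show "trans (relation_of extends A)"
        by (auto simp: trans_def relation_of_def intro: extends_trans pi)
      show "antisym (relation_of extends A)"
        by (auto simp: antisym_def relation_of_def intro: extends_antisym pi)
    qed
  next
    fix C assume C: "C \<in> Chains (relation_of extends A)"
    then have CA: "C \<subseteq> A" by (auto simp: Chains_def relation_of_def)
    have CM: "C \<subseteq> M" using CA pi partial_isometry_mem by blast
    show "\<exists>u\<in>A. \<forall>a\<in>C. extends a u"
    proof (cases "C = {}")
      case True
      have "adjoint (\<lambda>x::'a. 0::'a) = (\<lambda>x. 0)" by (rule adjoint_unique) simp
      then have "(\<lambda>x. 0) \<in> A"
        by (simp add: A_def partial_isometry_def zero_mem mem_zero[OF F])
      then show ?thesis using True by blast
    next
      case False
      have directed: "\<exists>U\<in>C. extends S U \<and> extends T U" if "S \<in> C" "T \<in> C" for S T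
      proof -
        have "extends S S" "extends T T"
          using that CA pi by (auto simp: extends_def partial_isometry_eq)
        moreover have "extends S T \<or> extends T S"
          using C that by (auto simp: Chains_def relation_of_def)
        ultimately show ?thesis using that by blast
      qed
      have piC: "partial_isometry W" if "W \<in> C" for W using that CA pi by blast
      obtain G L where G: "G \<noteq> bot" "\<forall>\<^sub>F T in G. T \<in> C" "\<And>S. S \<in> C \<Longrightarrow> \<forall>\<^sub>F T in G. extends S T"
        and L: "L \<in> M" "\<And>x. ((\<lambda>T. T x) \<longlongrightarrow> L x) G"
      proof (rule directed_limit[OF CM False _ directed])
        show "norm (T x) \<le> norm x" if "T \<in> C" for T x using norm_partial_isometry_le piC that by blast
        show "extends S U" if "S \<in> C" "T \<in> C" "extends S T" "extends T U" for S T U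
          using that extends_trans piC by blast
        show "S x \<bullet> U y = S x \<bullet> S y" if "S \<in> C" "U \<in> C" "extends S U" for S U x y
          using that extends_inner piC by blast
      qed (assumption | rule that)+
      have L_inner: "W x \<bullet> L y = W x \<bullet> W y" if W: "W \<in> C" for W x y
      proof (rule tendsto_unique[OF G(1)])
        show "((\<lambda>T. W x \<bullet> T y) \<longlongrightarrow> W x \<bullet> L y) G" by (intro tendsto_intros L)
        show "((\<lambda>T. W x \<bullet> T y) \<longlongrightarrow> W x \<bullet> W y) G"
          by (rule tendsto_eventually)
            (use G(2) G(3)[OF W] in eventually_elim, use W extends_inner piC in blast)
      qed
      have ext: "L (adjoint W (W x)) = W x" if W: "W \<in> C" for W x
      proof (rule tendsto_unique[OF G(1) L(2)])
        show "((\<lambda>T. T (adjoint W (W x))) \<longlongrightarrow> W x) G"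
          by (rule tendsto_eventually)
            (use G(3)[OF W] in eventually_elim, simp add: extends_def)
      qed
      \<comment> \<open>Strong convergence does not pass to adjoints in general, so the identity is
        tested against \<open>y\<close>: \<open>LW\<close> holds for each member of the chain, and
        both of its sides converge.\<close>
      have "L (adjoint L (L x)) = L x" for x
      proof (rule vector_eq_rdot[THEN iffD1], intro allI)
        fix y
        let ?z = "adjoint L y"
        have LW: "L x \<bullet> W ?z = W x \<bullet> y" if W: "W \<in> C" for W
        proof -
          have WM: "W \<in> M" using W CM by blast
          have "L x \<bullet> W ?z = W x \<bullet> W ?z"
            using L_inner[OF W, of ?z x] by (metis L_inner W inner_commute)
          also have "\<dots> = adjoint W (W x) \<bullet> ?z" by (simp add: adjoint_inner[OF WM])
          also have "\<dots> = W x \<bullet> y" by (simp add: ext[OF W] flip: inner_adjoint[OF L(1)])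
          finally show ?thesis .
        qed
        have ev: "\<forall>\<^sub>F W in G. W x \<bullet> y = L x \<bullet> W ?z"
          using G(2) by eventually_elim (simp add: LW)
        have "L x \<bullet> L ?z = L x \<bullet> y"
        proof (rule tendsto_unique[OF G(1)])
          show "((\<lambda>W. L x \<bullet> W ?z) \<longlongrightarrow> L x \<bullet> L ?z) G" by (intro tendsto_intros L)
          have "((\<lambda>W. W x \<bullet> y) \<longlongrightarrow> L x \<bullet> y) G" by (intro tendsto_intros L)
          then show "((\<lambda>W. L x \<bullet> W ?z) \<longlongrightarrow> L x \<bullet> y) G"
            using ev by (rule Lim_transform_eventually)
        qed
        then show "L (adjoint L (L x)) \<bullet> y = L x \<bullet> y"
          by (simp add: inner_adjoint[OF L(1), of "adjoint L _"] adjoint_inner[OF L(1)])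
      qed
      moreover have "L (E x) = L x" for x
      proof (rule tendsto_unique[OF G(1) L(2)])
        show "((\<lambda>T. T (E x)) \<longlongrightarrow> L x) G"
          by (rule Lim_transform_eventually[OF L(2)[of x]])
            (use G(2) in eventually_elim, use CA in \<open>auto simp: A_def\<close>)
      qed
      moreover have "F (L x) = L x" for x
      proof (rule tendsto_unique[OF G(1) _ L(2)])
        show "((\<lambda>T. T x) \<longlongrightarrow> F (L x)) G"
          by (rule Lim_transform_eventually[OF mem_tendsto[OF F L(2)[of x]]])
            (use G(2) in eventually_elim, use CA in \<open>auto simp: A_def\<close>)
      qed
      ultimately have "L \<in> A" using L(1) by (simp add: A_def partial_isometry_def)
      moreover have "\<forall>a\<in>C. extends a L" using ext by (simp add: extends_def)
      ultimately show ?thesis by blast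
    qed
  qed
  then show ?thesis using that by blast
qed

text \<open>The pieces of \<open>E\<close> and \<open>F\<close> left over by a maximal partial isometry \<open>W\<close> are
  separated by the algebra: a nonzero \<open>F' T E'\<close> would have a polar part extending \<open>W\<close>.\<close>

lemma maximal_remainder:
  assumes E: "projection E" and F: "projection F"
  obtains W where "partial_isometry W" "\<And>x. W (E x) = W x" "\<And>x. F (W x) = W x"
    "\<And>T x. T \<in> M \<Longrightarrow> F (T (E x - adjoint W (W x))) = W (adjoint W (T (E x - adjoint W (W x))))"
proof -
  let ?A = "{W. partial_isometry W \<and> (\<forall>x. W (E x) = W x) \<and> (\<forall>x. F (W x) = W x)}"
  obtain W where W_mem: "W \<in> ?A" and W_max: "\<And>U. U \<in> ?A \<Longrightarrow> extends W U \<Longrightarrow> U = W"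
  proof (rule maximal_partial_isometry[OF projection_mem[OF E] projection_mem[OF F]])
  qed (rule that)
  have W: "partial_isometry W" "\<And>x. W (E x) = W x" "\<And>x. F (W x) = W x"
    using W_mem by auto
  have max: "U = W" if "partial_isometry U" "\<And>x. U (E x) = U x" "\<And>x. F (U x) = U x" "extends W U" for U
    using W_max that by blast
  note WM = partial_isometry_mem[OF W(1)]
  note WM' = adjoint_mem[OF WM]
  note EM = projection_mem[OF E]
  note FM = projection_mem[OF F]
  have EW': "E (adjoint W y) = adjoint W y" for y
    by (rule vector_eq_rdot[THEN iffD1], intro allI)
      (simp add: projection_inner[OF E] adjoint_inner[OF WM] W(2))
  have W'F: "adjoint W (F y) = adjoint W y" for y
    by (rule vector_eq_rdot[THEN iffD1], intro allI)
      (simp add: adjoint_inner[OF WM] projection_inner[OF F] W(3))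
  \<comment> \<open>\<open>E'\<close> and \<open>F'\<close> are the parts of \<open>E\<close> and
    \<open>F\<close> outside the initial and the final space of \<open>W\<close>.\<close>
  define E' where "E' x = E x - adjoint W (W x)" for x
  define F' where "F' y = F y - W (adjoint W y)" for y
  have E'M: "E' \<in> M" unfolding E'_def [abs_def] by (rule diff_mem[OF EM comp_mem[OF WM' WM]])
  have F'M: "F' \<in> M" unfolding F'_def [abs_def] by (rule diff_mem[OF FM comp_mem[OF WM WM']])
  have WE': "W (E' x) = 0" for x
    by (simp add: E'_def mem_diff[OF WM] W(2) partial_isometry_eq[OF W(1)])
  have E'W': "E' (adjoint W y) = 0" for y
    by (simp add: E'_def EW' partial_isometry_adjoint_eq[OF W(1)])
  have W'F': "adjoint W (F' y) = 0" for y
    by (simp add: F'_def mem_diff[OF WM'] W'F partial_isometry_adjoint_eq[OF W(1)])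
  have E'E: "E' (E x) = E' x" for x
    by (simp add: E'_def projection_idem[OF E] W(2))
  have E'E': "E' (E' x) = E' x" for x
    by (subst (2) E'_def) (simp add: mem_diff[OF E'M] E'E E'W')
  have FF': "F (F' y) = F' y" for y
    by (simp add: F'_def mem_diff[OF FM] projection_idem[OF F] W(3))
  have F'F': "F' (F' y) = F' y" for y
    by (subst F'_def) (simp add: FF' W'F' mem_zero[OF WM])
  have F'_inner: "F' x \<bullet> y = x \<bullet> F' y" for x y
    by (simp add: F'_def inner_diff projection_inner[OF F] adjoint_inner[OF WM] inner_adjoint[OF WM])
  have zero: "F' (T (E' x)) = 0" if T: "T \<in> M" for T x
  proof (rule ccontr)
    define S where "S x = F' (T (E' x))" for x
    assume "F' (T (E' x)) \<noteq> 0"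
    then have "S x \<noteq> 0" by (simp add: S_def)
    moreover have S: "S \<in> M"
      unfolding S_def [abs_def] by (rule comp_mem[OF F'M comp_mem[OF T E'M]])
    ultimately obtain U x1 where U: "partial_isometry U" "U x1 \<noteq> 0" "\<And>x. S x = 0 \<Longrightarrow> U x = 0"
      "\<And>y. adjoint S y = 0 \<Longrightarrow> adjoint U y = 0"
      using polar_decomposition by blast
    note UM = partial_isometry_mem[OF U(1)]
    note UM' = adjoint_mem[OF UM]
    have UE': "U (E' v) = U v" for v
    proof -
      have "U (v - E' v) = 0"
        by (rule U(3)) (simp add: S_def mem_diff[OF E'M] E'E' mem_zero[OF T] mem_zero[OF F'M])
      then show ?thesis by (simp add: mem_diff[OF UM])
    qed
    have U'F': "adjoint U (F' v) = adjoint U v" for v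
    proof -
      have "adjoint U (v - F' v) = 0"
      proof (rule U(4))
        have "S z \<bullet> (v - F' v) = 0" for z
          by (simp add: S_def F'_inner mem_diff[OF F'M] F'F')
        then show "adjoint S (v - F' v) = 0" by (simp add: adjoint_eq_0_iff[OF S])
      qed
      then show ?thesis by (simp add: mem_diff[OF UM'])
    qed
    have F'U: "F' (U v) = U v" for v
      by (rule vector_eq_rdot[THEN iffD1], intro allI)
        (simp add: F'_inner inner_adjoint[OF UM] U'F')
    \<comment> \<open>\<open>U\<close> runs from \<open>E'\<close> to \<open>F'\<close>, so the four
      products of \<open>U\<close> or \<open>W\<close> with the adjoint of the other, in either
      order, vanish. This makes \<open>W + U\<close> a partial isometry extending
      \<open>W\<close>.\<close>
    have UW': "U (adjoint W y) = 0" for y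
      using UE'[of "adjoint W y"] by (simp add: E'W' mem_zero[OF UM])
    have WU': "W (adjoint U y) = 0" for y
    proof -
      have "W (adjoint U y) \<bullet> z = 0" for z
        by (simp add: inner_adjoint[OF WM] adjoint_inner[OF UM] UW')
      then show ?thesis by (metis inner_eq_zero_iff)
    qed
    have W'U: "adjoint W (U v) = 0" for v
      using W'F'[of "U v"] by (simp add: F'U)
    have U'W: "adjoint U (W v) = 0" for v
    proof -
      have "adjoint U (W v) \<bullet> z = 0" for z
        by (simp add: adjoint_inner[OF UM] inner_adjoint[OF WM] W'U)
      then show ?thesis by (metis inner_eq_zero_iff)
    qed
    let ?V = "\<lambda>x. W x + U x"
    have adjV: "adjoint ?V = (\<lambda>y. adjoint W y + adjoint U y)"
      by (rule adjoint_unique)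
        (simp add: inner_add inner_adjoint[OF WM] inner_adjoint[OF UM])
    have "?V = W"
    proof (rule max)
      show "partial_isometry ?V"
        unfolding partial_isometry_def
      proof (intro conjI allI)
        show "?V \<in> M" by (rule add_mem[OF WM UM])
        show "?V (adjoint ?V (?V x)) = ?V x" for x
          by (simp add: adjV mem_add[OF WM] mem_add[OF UM] mem_add[OF WM'] mem_add[OF UM']
              W'U U'W UW' WU' partial_isometry_eq[OF W(1)] partial_isometry_eq[OF U(1)])
      qed
      show "?V (E x) = ?V x" for x
        using UE'[of "E x"] UE'[of x] by (simp add: W(2) E'E)
      show "F (?V x) = ?V x" for x
        using FF'[of "U x"] by (simp add: mem_add[OF FM] W(3) F'U)
      show "extends W ?V"
        by (simp add: extends_def partial_isometry_eq[OF W(1)] UW')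
    qed
    then have "W x1 + U x1 = W x1" by metis
    then show False using U(2) by simp
  qed
  show ?thesis
  proof (rule that[OF W])
    show "F (T (E x - adjoint W (W x))) = W (adjoint W (T (E x - adjoint W (W x))))"
      if "T \<in> M" for T x
      using zero[OF that, of x] by (simp add: F'_def E'_def)
  qed
qed

definition central :: "('a \<Rightarrow> 'a) \<Rightarrow> bool" where
  "central Q \<longleftrightarrow> (\<forall>T\<in>M. \<forall>x. Q (T x) = T (Q x))"

text \<open>\<open>Q\<close> is the central support of the remainder \<open>E'\<close> left by a
  maximal \<open>W\<close>. So \<open>E'\<close> vanishes on the range of \<open>1 - Q\<close>,
  while \<open>F'\<close> vanishes on the range of \<open>Q\<close> because
  \<open>E' T F' = 0\<close> for all \<open>T\<close> in the algebra.\<close>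

lemma projection_comparison:
  assumes E: "projection E" and F: "projection F"
  obtains W Q where "partial_isometry W" "\<And>x. W (E x) = W x" "\<And>x. F (W x) = W x"
    "projection Q" "central Q" "\<And>x. F (Q x) = W (adjoint W (Q x))"
    "\<And>x. E (x - Q x) = adjoint W (W (x - Q x))"
proof -
  obtain W where W: "partial_isometry W" "\<And>x. W (E x) = W x" "\<And>x. F (W x) = W x"
    and sep: "\<And>T x. T \<in> M \<Longrightarrow>
      F (T (E x - adjoint W (W x))) = W (adjoint W (T (E x - adjoint W (W x))))"
    using maximal_remainder[OF E F] by metis
  note WM = partial_isometry_mem[OF W(1)]
  note WM' = adjoint_mem[OF WM]
  define E' where "E' x = E x - adjoint W (W x)" for x
  define F' where "F' y = F y - W (adjoint W y)" for y
  have E'M: "E' \<in> M"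
    unfolding E'_def [abs_def] by (rule diff_mem[OF projection_mem[OF E] comp_mem[OF WM' WM]])
  have F'M: "F' \<in> M"
    unfolding F'_def [abs_def] by (rule diff_mem[OF projection_mem[OF F] comp_mem[OF WM WM']])
  have E'_inner: "E' x \<bullet> y = x \<bullet> E' y" for x y
    by (simp add: E'_def inner_diff projection_inner[OF E] adjoint_inner[OF WM] inner_adjoint[OF WM])
  have F'_inner: "F' x \<bullet> y = x \<bullet> F' y" for x y
    by (simp add: F'_def inner_diff projection_inner[OF F] adjoint_inner[OF WM] inner_adjoint[OF WM])
  have FTE: "F' (T (E' x)) = 0" if "T \<in> M" for T x
    using sep[OF that, of x] by (simp add: F'_def E'_def)
  have ETF: "E' (T (F' x)) = 0" if T: "T \<in> M" for T x
  proof -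
    have "E' (T (F' x)) \<bullet> y = 0" for y
      by (simp add: E'_inner inner_adjoint[OF T] F'_inner FTE[OF adjoint_mem[OF T]])
    then show ?thesis by (metis inner_eq_zero_iff)
  qed
  have "(\<lambda>T x. E' (T x)) ` M \<subseteq> M" using comp_mem[OF E'M] by blast
  then obtain Q where Q: "projection Q" "\<And>x. Q x = 0 \<longleftrightarrow> (\<forall>T\<in>M. E' (T x) = 0)"
    by (rule joint_support_projection) auto
  note QM = projection_mem[OF Q(1)]
  have QQ: "Q (x - Q x) = 0" for x
    by (simp add: mem_diff[OF QM] projection_idem[OF Q(1)])
  \<comment> \<open>The null space of \<open>Q\<close> is invariant under the algebra, whence
    \<open>Q S = Q S Q\<close>. Taking adjoints gives \<open>SQ\<close>, and together they show that
    \<open>Q\<close> commutes with \<open>S\<close>.\<close>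
  have QS: "Q (S x) = Q (S (Q x))" if S: "S \<in> M" for S x
  proof -
    have *: "\<forall>T\<in>M. E' (T (x - Q x)) = 0" using QQ[of x] Q(2) by simp
    have "E' (T (S (x - Q x))) = 0" if "T \<in> M" for T
      using bspec[OF * comp_mem[OF that S]] .
    then have "Q (S (x - Q x)) = 0" by (simp add: Q(2))
    then show ?thesis by (simp add: mem_diff[OF S] mem_diff[OF QM])
  qed
  have SQ: "S (Q x) = Q (S (Q x))" if S: "S \<in> M" for S x
  proof (rule vector_eq_rdot[THEN iffD1], intro allI)
    fix y
    have "S (Q x) \<bullet> y = x \<bullet> Q (adjoint S y)"
      by (simp add: inner_adjoint[OF S] projection_inner[OF Q(1)])
    also have "\<dots> = x \<bullet> Q (adjoint S (Q y))" using QS[OF adjoint_mem[OF S]] by simp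
    also have "\<dots> = Q (S (Q x)) \<bullet> y"
      by (simp add: projection_inner[OF Q(1)] inner_adjoint[OF S])
    finally show "S (Q x) \<bullet> y = Q (S (Q x)) \<bullet> y" .
  qed
  have central: "central Q"
    unfolding central_def using QS SQ by metis
  show ?thesis
  proof (rule that[OF W Q(1) central])
    fix x
    have "Q (F' x) = 0" using ETF by (simp add: Q(2))
    then have "F' (Q x) = 0" using central F'M by (simp add: central_def)
    then show "F (Q x) = W (adjoint W (Q x))" by (simp add: F'_def)
    \<comment> \<open>The identity is one of the operators \<open>T\<close> that define the null
      space of \<open>Q\<close>.\<close>
    have "E' (x - Q x) = 0" using QQ[of x] id_mem unfolding Q(2) by fastforce
    then show "E (x - Q x) = adjoint W (W (x - Q x))" by (simp add: E'_def)
  qed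
qed

section \<open>Equality of quotients\<close>

text \<open>If \<open>A h = B k\<close>, then
  \<open>adjoint A y \<bullet> h = adjoint B y \<bullet> k\<close> is at most \<open>norm k\<close>
  in absolute value when \<open>norm (adjoint B y) \<le> 1\<close>. Uniform boundedness turns these
  bounds, one for each \<open>h\<close>, into a single one, and homogeneity does the rest.\<close>

lemma range_subset_imp_majorised:
  assumes A: "A \<in> M" and B: "B \<in> M" and range: "range A \<subseteq> range B"
  obtains c where "\<And>y. norm (adjoint A y) \<le> c * norm (adjoint B y)"
proof -
  note A' = adjoint_mem[OF A]
  note B' = adjoint_mem[OF B]
  obtain K where K: "\<And>s. s \<in> adjoint A ` {y. norm (adjoint B y) \<le> 1} \<Longrightarrow> norm s \<le> K"
  proof (rule weakly_bounded_imp_bounded[of "adjoint A ` {y. norm (adjoint B y) \<le> 1}"])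
    fix h
    obtain k where k: "A h = B k" using range by blast
    have "\<bar>adjoint A y \<bullet> h\<bar> \<le> norm k" if "norm (adjoint B y) \<le> 1" for y
    proof -
      have "adjoint A y \<bullet> h = adjoint B y \<bullet> k" by (simp add: adjoint_inner[OF A] adjoint_inner[OF B] k)
      also have "\<bar>\<dots>\<bar> \<le> norm (adjoint B y) * norm k" by (rule Cauchy_Schwarz_ineq2)
      also have "\<dots> \<le> 1 * norm k" using that by (rule mult_right_mono) simp
      finally show ?thesis by simp
    qed
    then show "\<exists>k. \<forall>s\<in>adjoint A ` {y. norm (adjoint B y) \<le> 1}. \<bar>s \<bullet> h\<bar> \<le> k" by blast
  qed (rule that)
  have K: "norm (adjoint A y) \<le> K" if "norm (adjoint B y) \<le> 1" for y
    using K that by blast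
  have "norm (adjoint A y) \<le> K * norm (adjoint B y)" for y
  proof (cases "adjoint B y = 0")
    case True
    have "norm (adjoint A y) = 0"
    proof (rule ccontr)
      assume nz: "norm (adjoint A y) \<noteq> 0"
      \<comment> \<open>All multiples of \<open>y\<close> satisfy the condition in \<open>K\<close>,
        but this one has an image of norm \<open>\<bar>K\<bar> + 1\<close>.\<close>
      let ?t = "(\<bar>K\<bar> + 1) / norm (adjoint A y)"
      have "norm (adjoint A (?t *\<^sub>R y)) \<le> K"
        by (rule K) (simp add: mem_scaleR[OF B'] True)
      then show False using nz by (simp add: mem_scaleR[OF A'])
    qed
    then show ?thesis using True by simp
  next
    case False
    have "norm (adjoint A ((1 / norm (adjoint B y)) *\<^sub>R y)) \<le> K"
      by (rule K) (use False in \<open>simp add: mem_scaleR[OF B']\<close>)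
    then show ?thesis using False by (simp add: mem_scaleR[OF A'] field_simps)
  qed
  then show ?thesis by (rule that)
qed

text \<open>The majorisation concerns adjoints, so \<open>V\<close> is the adjoint of the quotient
  of \<open>adjoint A\<close> by \<open>adjoint B\<close>. The last conclusion makes the range of
  \<open>V\<close> orthogonal to the null space of \<open>B\<close>.\<close>

lemma range_factorisation:
  assumes A: "A \<in> M" and B: "B \<in> M" and "range A \<subseteq> range B"
  obtains V where "V \<in> M" "\<And>x. B (V x) = A x" "\<And>v. B v = 0 \<Longrightarrow> adjoint V v = 0"
proof -
  obtain c where "\<And>y. norm (adjoint A y) \<le> c * norm (adjoint B y)"
    using range_subset_imp_majorised[OF assms] by blast
  then obtain W where W: "W \<in> M" "\<And>y. W (adjoint B y) = adjoint A y" "\<And>v. B v = 0 \<Longrightarrow> W v = 0"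
    using quotient_mem[OF adjoint_mem[OF A] adjoint_mem[OF B]] adjoint_adjoint[OF B] by metis
  show ?thesis
  proof (rule that)
    show "adjoint W \<in> M" using W(1) by (rule adjoint_mem)
    show "B (adjoint W x) = A x" for x
    proof (rule vector_eq_rdot[THEN iffD1], intro allI)
      fix y
      have "B (adjoint W x) \<bullet> y = x \<bullet> W (adjoint B y)"
        by (simp only: inner_adjoint[OF B] adjoint_inner[OF W(1)])
      then show "B (adjoint W x) \<bullet> y = A x \<bullet> y"
        by (simp only: W(2) inner_adjoint[OF A])
    qed
    show "adjoint (adjoint W) v = 0" if "B v = 0" for v
      using W(3)[OF that] by (simp add: adjoint_adjoint[OF W(1)])
  qed
qed

lemma equal_quotients_imp_intertwined:
  assumes M: "A1 \<in> M" "B1 \<in> M" "A2 \<in> M" "B2 \<in> M"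
    and range: "range B1 = range B2" and eq: "\<And>x y. B1 x = B2 y \<Longrightarrow> A1 x = A2 y"
  obtains C D Q where "C \<in> M" "D \<in> M" "\<And>x. C (D x) = x" "projection Q" "central Q"
    "\<And>x. A1 (Q x) = A2 (C (Q x))" "\<And>x. B1 (Q x) = B2 (C (Q x))"
    "\<And>x. A2 (x - Q x) = A1 (C (x - Q x))" "\<And>x. B2 (x - Q x) = B1 (C (x - Q x))"
proof -
  have null1: "A1 x = 0" if "B1 x = 0" for x
    using eq[of x 0] that by (simp add: mem_zero[OF M(4)] mem_zero[OF M(3)])
  have null2: "A2 x = 0" if "B2 x = 0" for x
    using eq[of 0 x] that by (simp add: mem_zero[OF M(2)] mem_zero[OF M(1)])
  obtain E where E: "projection E" "\<And>x. E x = x \<longleftrightarrow> B1 x = 0" "\<And>x. B1 (E x) = 0"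
    using null_projection[OF M(2)] by blast
  obtain F where F: "projection F" "\<And>x. F x = x \<longleftrightarrow> B2 x = 0" "\<And>x. B2 (F x) = 0"
    using null_projection[OF M(4)] by blast
  obtain V where V: "V \<in> M" "\<And>x. B2 (V x) = B1 x" "\<And>v. B2 v = 0 \<Longrightarrow> adjoint V v = 0"
    using range_factorisation[OF M(2,4)] range by blast
  obtain V' where V': "V' \<in> M" "\<And>x. B1 (V' x) = B2 x" "\<And>v. B1 v = 0 \<Longrightarrow> adjoint V' v = 0"
    using range_factorisation[OF M(4,2)] range by blast
  obtain W Q where W: "partial_isometry W" "\<And>x. W (E x) = W x" "\<And>x. F (W x) = W x"
    and Q: "projection Q" "central Q" "\<And>x. F (Q x) = W (adjoint W (Q x))"
    "\<And>x. E (x - Q x) = adjoint W (W (x - Q x))"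
    using projection_comparison[OF E(1) F(1)] by metis
  note EM = projection_mem[OF E(1)] and FM = projection_mem[OF F(1)]
  note QM = projection_mem[OF Q(1)]
  note WM = partial_isometry_mem[OF W(1)]
  note WM' = adjoint_mem[OF WM]
  have W'F: "adjoint W (F x) = adjoint W x" for x
    by (rule vector_eq_rdot[THEN iffD1], intro allI)
      (simp add: adjoint_inner[OF WM] projection_inner[OF F(1)] W(3))
  have EW': "E (adjoint W x) = adjoint W x" for x
    by (rule vector_eq_rdot[THEN iffD1], intro allI)
      (simp add: adjoint_inner[OF WM] projection_inner[OF E(1)] W(2))
  have FV: "F (V x) = 0" for x
  proof -
    have "F (V x) \<bullet> y = 0" for y
      by (simp add: projection_inner[OF F(1)] inner_adjoint[OF V(1)] V(3) F(3))
    then show ?thesis by (metis inner_eq_zero_iff)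
  qed
  have EV': "E (V' x) = 0" for x
  proof -
    have "E (V' x) \<bullet> y = 0" for y
      by (simp add: projection_inner[OF E(1)] inner_adjoint[OF V'(1)] V'(3) E(3))
    then show ?thesis by (metis inner_eq_zero_iff)
  qed
  \<comment> \<open>\<open>V (E x)\<close> lies in the null space of \<open>B2\<close>, which
    \<open>F\<close> fixes, yet \<open>F\<close> kills the range of \<open>V\<close>.\<close>
  have VE: "V (E x) = 0" for x
    using F(2)[of "V (E x)"] by (simp add: V(2) E(3) FV)
  have V'F: "V' (F x) = 0" for x
    using E(2)[of "V' (F x)"] by (simp add: V'(2) F(3) EV')
  \<comment> \<open>The values of \<open>V V' - 1\<close> lie in the null space of \<open>B2\<close>
    and are fixed by \<open>F\<close>; as \<open>F V = 0\<close>, they equal those of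
    \<open>- F\<close>.\<close>
  have VV': "V (V' x) = x - F x" for x
  proof -
    have "F (V (V' x) - x) = V (V' x) - x"
      by (simp add: F(2) mem_diff[OF M(4)] V(2) V'(2))
    then show ?thesis by (simp add: mem_diff[OF FM] FV algebra_simps)
  qed
  have V'V: "V' (V x) = x - E x" for x
  proof -
    have "E (V' (V x) - x) = V' (V x) - x"
      by (simp add: E(2) mem_diff[OF M(2)] V(2) V'(2))
    then show ?thesis by (simp add: mem_diff[OF EM] EV' algebra_simps)
  qed
  have WV': "W (V' x) = 0" for x using W(2)[of "V' x"] by (simp add: EV' mem_zero[OF WM])
  have W'V: "adjoint W (V x) = 0" for x using W'F[of "V x"] by (simp add: FV mem_zero[OF WM'])
  have VW': "V (adjoint W x) = 0" for x using VE[of "adjoint W x"] by (simp add: EW')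
  have V'W: "V' (W x) = 0" for x using V'F[of "W x"] by (simp add: W(3))
  have B2W: "B2 (W x) = 0" for x using F(2)[of "W x"] by (simp add: W(3))
  have B1W': "B1 (adjoint W x) = 0" for x using E(2)[of "adjoint W x"] by (simp add: EW')
  \<comment> \<open>\<open>X X' = 1 - F + W W\<^sup>*\<close> is the identity on the range of
    \<open>Q\<close>, and \<open>X' X = 1 - E + W\<^sup>* W\<close> on that of \<open>1 - Q\<close>.
    So \<open>C\<close> uses \<open>X\<close> on the first and \<open>X'\<close> on the second, and
    \<open>D\<close> the opposite.\<close>
  define X where "X x = V x + W x" for x
  define X' where "X' x = V' x + adjoint W x" for x
  define C where "C x = X (Q x) + X' (x - Q x)" for x
  define D where "D x = X' (Q x) + X (x - Q x)" for x
  have X: "X \<in> M" unfolding X_def [abs_def] by (rule add_mem[OF V(1) WM])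
  have X': "X' \<in> M" unfolding X'_def [abs_def] by (rule add_mem[OF V'(1) WM'])
  have XX': "X (X' (Q x)) = Q x" for x
    by (simp add: X_def X'_def mem_add[OF V(1)] mem_add[OF WM] VV' VW' WV' Q(3))
  have X'X: "X' (X (x - Q x)) = x - Q x" for x
    using Q(4)[of x]
    by (simp add: X_def X'_def mem_add[OF V'(1)] mem_add[OF WM'] V'V V'W W'V)
  have QQ: "Q (Q x) = Q x" for x by (rule projection_idem[OF Q(1)])
  have comm: "Q (T x) = T (Q x)" if "T \<in> M" for T x using Q(2) that by (simp add: central_def)
  have complement: "T x - T (Q x) = T (x - Q x)" if "T \<in> M" for T x by (simp add: mem_diff[OF that])
  have X0: "X 0 = 0" and X'0: "X' 0 = 0" and Q0: "Q 0 = 0"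
    by (rule mem_zero[OF X] mem_zero[OF X'] mem_zero[OF QM])+
  have QD: "Q (D x) = X' (Q x)" for x
    by (simp add: D_def mem_add[OF QM] mem_diff[OF QM] comm[OF X] comm[OF X'] QQ X0)
  have CQ: "C (Q x) = X (Q x)" and CQ': "C (x - Q x) = X' (x - Q x)" for x
    by (simp_all add: C_def QQ mem_diff[OF QM] X0 X'0)
  show ?thesis
  proof (rule that[OF _ _ _ Q(1,2)])
    have Qc: "(\<lambda>x. x - Q x) \<in> M" by (rule diff_mem[OF id_mem QM])
    show "C \<in> M"
      unfolding C_def [abs_def] by (rule add_mem[OF comp_mem[OF X QM] comp_mem[OF X' Qc]])
    show "D \<in> M"
      unfolding D_def [abs_def] by (rule add_mem[OF comp_mem[OF X' QM] comp_mem[OF X Qc]])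
    show "C (D x) = x" for x
    proof -
      have "D x - Q (D x) = X (x - Q x)" unfolding QD by (simp add: D_def)
      then show ?thesis by (simp add: C_def QD XX' X'X)
    qed
    show B1Q: "B1 (Q x) = B2 (C (Q x))" for x
      by (simp add: CQ X_def mem_add[OF M(4)] V(2) B2W)
    show B2Q: "B2 (x - Q x) = B1 (C (x - Q x))" for x
      by (simp add: CQ' X'_def mem_add[OF M(2)] V'(2) B1W')
    show "A1 (Q x) = A2 (C (Q x))" for x by (rule eq[OF B1Q])
    show "A2 (x - Q x) = A1 (C (x - Q x))" for x by (rule eq[OF B2Q[symmetric], symmetric])
  qed
qed

text \<open>The witness is \<open>C (P x) + D (Q x)\<close>. For its second summand the relations on
  \<open>Q\<close> are used at \<open>D (Q x)\<close>, which commutation keeps in the range of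
  \<open>Q\<close> and which \<open>C\<close> sends back to \<open>Q x\<close>.\<close>

lemma intertwined_lift:
  assumes M: "A1 \<in> M" "B1 \<in> M" "A2 \<in> M" "B2 \<in> M" and CD: "\<And>x. C (D x) = x"
    and PQ: "\<And>x. P x + Q x = x" and QQ: "\<And>x. Q (Q x) = Q x" and QD: "\<And>x. Q (D x) = D (Q x)"
    and P: "\<And>x. A1 (P x) = A2 (C (P x))" "\<And>x. B1 (P x) = B2 (C (P x))"
    and Q: "\<And>x. A2 (Q x) = A1 (C (Q x))" "\<And>x. B2 (Q x) = B1 (C (Q x))"
  shows "\<exists>y. B2 y = B1 x \<and> A2 y = A1 x"
proof -
  have QDQ: "Q (D (Q x)) = D (Q x)" by (simp only: QD QQ)
  have lift_Q: "A1 (Q x) = A2 (D (Q x))" "B1 (Q x) = B2 (D (Q x))"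
    using Q(1)[of "D (Q x)"] Q(2)[of "D (Q x)"] unfolding QDQ CD by simp_all
  have "A1 x = A2 (C (P x)) + A2 (D (Q x))"
    using mem_add[OF M(1), of "P x" "Q x"] unfolding PQ P(1) lift_Q .
  moreover have "B1 x = B2 (C (P x)) + B2 (D (Q x))"
    using mem_add[OF M(2), of "P x" "Q x"] unfolding PQ P(2) lift_Q .
  ultimately show ?thesis
    by (intro exI[of _ "C (P x) + D (Q x)"]) (simp add: mem_add[OF M(3)] mem_add[OF M(4)])
qed

end

section \<open>From complex von Neumann algebras to real strongly closed ones\<close>

lemma cinner_scaleC_right: "cinner x (c *\<^sub>C y) = cnj c * cinner x y"
  by (metis cinner_commute cinner_scaleC_left complex_cnj_mult)

lemma inner_scaleC_left: "(c *\<^sub>C x) \<bullet> y = x \<bullet> (cnj c *\<^sub>C y)"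
  by (simp add: inner_eq_Re_cinner cinner_scaleC_left cinner_scaleC_right)

text \<open>Conjugate linearity in the second argument makes the imaginary part of
  \<open>cinner x y\<close> the real part of \<open>cinner x (\<i> *\<^sub>C y)\<close>. Limits and
  symmetry can thus be checked on the real inner product.\<close>

lemma cinner_eq_inner: "cinner x y = Complex (x \<bullet> y) (x \<bullet> (\<i> *\<^sub>C y))"
  by (rule complex_eqI) (simp_all add: inner_eq_Re_cinner cinner_scaleC_right)

lemma strong_limit_bounded_operator:
  assumes "F \<noteq> bot" and F: "\<forall>\<^sub>F T in F. T \<in> bounded_operators"
    and K: "\<forall>\<^sub>F T in F. \<forall>x. norm (T x) \<le> K * norm x"
    and L: "\<And>x. ((\<lambda>T. T x) \<longlongrightarrow> L x) F"
  shows "L \<in> bounded_operators"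
proof -
  have "L (x + y) = L x + L y" for x y
  proof (rule tendsto_unique[OF assms(1) L])
    have "((\<lambda>T. T x + T y) \<longlongrightarrow> L x + L y) F" by (intro tendsto_intros L)
    then show "((\<lambda>T. T (x + y)) \<longlongrightarrow> L x + L y) F"
      by (rule Lim_transform_eventually)
        (use F in eventually_elim, simp add: bounded_operators_def linear_simps)
  qed
  \<comment> \<open>Moving the scalar across the inner product reduces complex homogeneity to limits
    of real inner products.\<close>
  moreover have scale: "L (c *\<^sub>C x) = c *\<^sub>C L x" for c x
  proof (rule vector_eq_rdot[THEN iffD1], intro allI)
    fix y
    have "((\<lambda>T. T x \<bullet> (cnj c *\<^sub>C y)) \<longlongrightarrow> L x \<bullet> (cnj c *\<^sub>C y)) F"
      by (intro tendsto_intros L)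
    then have "((\<lambda>T. T (c *\<^sub>C x) \<bullet> y) \<longlongrightarrow> (c *\<^sub>C L x) \<bullet> y) F"
      unfolding inner_scaleC_left[symmetric]
      by (rule Lim_transform_eventually)
        (use F in eventually_elim, simp add: bounded_operators_def)
    moreover have "((\<lambda>T. T (c *\<^sub>C x) \<bullet> y) \<longlongrightarrow> L (c *\<^sub>C x) \<bullet> y) F"
      by (intro tendsto_intros L)
    ultimately show "L (c *\<^sub>C x) \<bullet> y = (c *\<^sub>C L x) \<bullet> y"
      using tendsto_unique[OF assms(1)] by blast
  qed
  moreover have "norm (L x) \<le> norm x * K" for x
  proof (rule Lim_norm_ubound[OF assms(1) L])
    show "\<forall>\<^sub>F T in F. norm (T x) \<le> norm x * K"
      using K by eventually_elim (simp add: mult.commute)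
  qed
  moreover have "L (r *\<^sub>R x) = r *\<^sub>R L x" for r x
    using scale[of "complex_of_real r" x] by (simp add: scaleC_of_real)
  ultimately show ?thesis
    unfolding bounded_operators_def by (auto intro!: bounded_linear_intro[where K = K])
qed

text \<open>Strong convergence gives convergence of every coefficient \<open>cinner (T x) y\<close>,
  so a limit outside \<open>M\<close> would force the operators eventually into the weakly open
  complement of \<open>M\<close>.\<close>

lemma weak_operator_closed_limit:
  assumes closed: "closedin weak_operator_topology M"
    and F: "F \<noteq> bot" "\<forall>\<^sub>F T in F. T \<in> M"
    and L: "L \<in> bounded_operators" "\<And>x. ((\<lambda>T. T x) \<longlongrightarrow> L x) F"
  shows "L \<in> M"
proof (rule ccontr)
  assume "L \<notin> M"
  let ?f = "\<lambda>T (x, y). cinner (T x) y"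
  have top: "topspace weak_operator_topology = (bounded_operators :: ('a \<Rightarrow> 'a) set)"
    by (simp add: weak_operator_topology_def topspace_pullback_topology)
  obtain U where U: "open U" "bounded_operators - M = ?f -` U \<inter> bounded_operators"
    using closed unfolding closedin_def top
    unfolding weak_operator_topology_def openin_pullback_topology by auto
  have M: "M \<subseteq> bounded_operators" using closedin_subset[OF closed] top by simp
  have "limitin (product_topology (\<lambda>_. euclidean) UNIV) ?f (?f L) F"
  proof (simp add: limitin_componentwise, intro allI)
    fix x y
    show "((\<lambda>T. cinner (T x) y) \<longlongrightarrow> cinner (L x) y) F"
      unfolding cinner_eq_inner by (intro tendsto_Complex tendsto_intros L)
  qed
  then have "(?f \<longlongrightarrow> ?f L) F"
    by (simp add: euclidean_product_topology flip: limitin_canonical_iff)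
  moreover have "?f L \<in> U" using U(2) L(1) \<open>L \<notin> M\<close> by blast
  ultimately have "\<forall>\<^sub>F T in F. ?f T \<in> U" using U(1) by (simp add: topological_tendstoD)
  with F(2) have "\<forall>\<^sub>F T in F. False"
    by eventually_elim (use U(2) M in blast)
  then show False using F(1) by (simp add: trivial_limit_def)
qed

lemma von_neumann_algebra_strongly_closed:
  assumes "von_neumann_algebra M"
  shows "strongly_closed_star_algebra M"
proof (rule strongly_closed_star_algebra.intro)
  have M: "M \<subseteq> bounded_operators" "closedin weak_operator_topology M"
    using assms by (auto simp: von_neumann_algebra_def)
  show "bounded_linear T" if "T \<in> M" for T
    using M that by (auto simp: bounded_operators_def)
  show "(\<lambda>x. x) \<in> M" using assms by (simp add: von_neumann_algebra_def id_def)
  show "(\<lambda>x. S x + T x) \<in> M" if "S \<in> M" "T \<in> M" for S T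
    using assms that by (simp add: von_neumann_algebra_def)
  show "(\<lambda>x. c *\<^sub>R T x) \<in> M" if "T \<in> M" for c T
  proof -
    have "(\<lambda>x. complex_of_real c *\<^sub>C T x) \<in> M"
      using assms that by (simp add: von_neumann_algebra_def)
    then show ?thesis by (simp add: scaleC_of_real)
  qed
  show "(\<lambda>x. S (T x)) \<in> M" if "S \<in> M" "T \<in> M" for S T
    using assms that by (simp add: von_neumann_algebra_def comp_def)
  show "\<exists>S\<in>M. \<forall>x y. T x \<bullet> y = x \<bullet> S y" if T: "T \<in> M" for T
  proof -
    have "\<forall>T\<in>M. \<exists>S\<in>M. is_adjoint T S" using assms by (simp add: von_neumann_algebra_def)
    then obtain S where "S \<in> M" "is_adjoint T S" using T by blast
    then show ?thesis by (auto simp: is_adjoint_def inner_eq_Re_cinner)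
  qed
  show "L \<in> M" if F: "F \<noteq> bot" "\<forall>\<^sub>F T in F. T \<in> M" and
    bound: "\<forall>\<^sub>F T in F. \<forall>x. norm (T x) \<le> K * norm x" and
    L: "\<And>x. ((\<lambda>T. T x) \<longlongrightarrow> L x) F" for F K L
  proof (rule weak_operator_closed_limit[OF M(2) F _ L])
    have "\<forall>\<^sub>F T in F. T \<in> bounded_operators" using F(2) by eventually_elim (use M in auto)
    then show "L \<in> bounded_operators" by (rule strong_limit_bounded_operator[OF F(1) _ bound L])
  qed
qed

section \<open>Equality of quotients as partial maps\<close>

lemma operator_quotient_eq_iff:
  assumes 1: "A1 \<in> bounded_operators" "B1 \<in> bounded_operators" "null_space B1 \<subseteq> null_space A1"
    and 2: "A2 \<in> bounded_operators" "B2 \<in> bounded_operators" "null_space B2 \<subseteq> null_space A2"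
  shows "operator_quotient A1 B1 = operator_quotient A2 B2 \<longleftrightarrow>
    range B1 = range B2 \<and> (\<forall>x y. B1 x = B2 y \<longrightarrow> A1 x = A2 y)"
proof
  assume eq: "operator_quotient A1 B1 = operator_quotient A2 B2"
  then have "range B1 = range B2" by (metis dom_operator_quotient)
  moreover have "A1 x = A2 y" if "B1 x = B2 y" for x y
    using operator_quotient_apply[OF 1, of x] operator_quotient_apply[OF 2, of y] eq that by simp
  ultimately show "range B1 = range B2 \<and> (\<forall>x y. B1 x = B2 y \<longrightarrow> A1 x = A2 y)" by blast
next
  assume R: "range B1 = range B2 \<and> (\<forall>x y. B1 x = B2 y \<longrightarrow> A1 x = A2 y)"
  show "operator_quotient A1 B1 = operator_quotient A2 B2"
  proof
    fix z
    show "operator_quotient A1 B1 z = operator_quotient A2 B2 z"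
    proof (cases "z \<in> range B1")
      case True
      then obtain x y where xy: "z = B1 x" "z = B2 y" using R by blast
      then have "A1 x = A2 y" using R by blast
      then show ?thesis
        using operator_quotient_apply[OF 1, of x] operator_quotient_apply[OF 2, of y] xy by simp
    next
      case False
      then show ?thesis using R by (simp add: operator_quotient_def)
    qed
  qed
qed

theorem theorem4p4:
  fixes M :: "('a::complex_hilbert_space \<Rightarrow> 'a) set"
    and A1 B1 A2 B2 :: "'a \<Rightarrow> 'a"
  assumes "von_neumann_algebra M"
    and "A1 \<in> M" "B1 \<in> M" "null_space B1 \<subseteq> null_space A1"
    and "A2 \<in> M" "B2 \<in> M" "null_space B2 \<subseteq> null_space A2"
  shows "operator_quotient A1 B1 = operator_quotient A2 B2 \<longleftrightarrow>
    (\<exists>C\<in>M. right_invertible_in M C \<and>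
      (\<exists>P\<in>centre M. \<exists>Q\<in>centre M.
        is_projection P \<and> is_projection Q \<and> (\<lambda>x. P x + Q x) = id \<and>
        A1 \<circ> P = A2 \<circ> C \<circ> P \<and> B1 \<circ> P = B2 \<circ> C \<circ> P \<and>
        A2 \<circ> Q = A1 \<circ> C \<circ> Q \<and> B2 \<circ> Q = B1 \<circ> C \<circ> Q))"
proof -
  interpret strongly_closed_star_algebra M using assms(1) by (rule von_neumann_algebra_strongly_closed)
  have bounded: "M \<subseteq> bounded_operators" using assms(1) by (simp add: von_neumann_algebra_def)
  have eq_iff: "operator_quotient A1 B1 = operator_quotient A2 B2 \<longleftrightarrow>
      range B1 = range B2 \<and> (\<forall>x y. B1 x = B2 y \<longrightarrow> A1 x = A2 y)"
    using assms bounded by (intro operator_quotient_eq_iff) auto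
  \<comment> \<open>Complex linearity lifts real symmetry to the complex inner product: the
    imaginary part is handled by real symmetry at \<open>\<i> *\<^sub>C y\<close>.\<close>
  have is_projection: "is_projection P" if "projection P" for P
  proof -
    have PM: "P \<in> bounded_operators" using projection_mem[OF that] bounded by blast
    then have "P (c *\<^sub>C x) = c *\<^sub>C P x" for c x by (simp add: bounded_operators_def)
    then have "cinner (P x) y = cinner x (P y)" for x y
      using projection_inner[OF that, of x y] projection_inner[OF that, of x "\<i> *\<^sub>C y"]
      by (simp add: cinner_eq_inner)
    then show ?thesis
      using PM projection_idem[OF that] by (auto simp: is_projection_def is_adjoint_def)
  qed
  have centre: "P \<in> centre M" if "P \<in> M" "central P" for P
    using that by (auto simp: centre_def central_def)
  show ?thesis
    unfolding eq_iff
  proof (rule iffI, goal_cases)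
    case 1
    then have range: "range B1 = range B2" and eq: "\<And>x y. B1 x = B2 y \<Longrightarrow> A1 x = A2 y" by auto
    obtain C D Q where C: "C \<in> M" "D \<in> M" "\<And>x. C (D x) = x" and Q: "projection Q" "central Q"
      and eqs: "\<And>x. A1 (Q x) = A2 (C (Q x))" "\<And>x. B1 (Q x) = B2 (C (Q x))"
        "\<And>x. A2 (x - Q x) = A1 (C (x - Q x))" "\<And>x. B2 (x - Q x) = B1 (C (x - Q x))"
    proof (rule equal_quotients_imp_intertwined[OF assms(2,3,5,6) range])
    qed (assumption | rule that eq)+
    \<comment> \<open>The central projection \<open>Q\<close> just obtained serves as
      \<open>P\<close> in the theorem, and its complement as \<open>Q\<close>.\<close>
    let ?Q' = "\<lambda>x. x - Q x"
    have Q': "projection ?Q'" using Q(1) by (rule projection_complement)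
    have "central ?Q'" using Q(2) by (simp add: central_def mem_diff)
    with Q' have "?Q' \<in> centre M" "is_projection ?Q'"
      using centre projection_mem is_projection by blast+
    moreover have "Q \<in> centre M" "is_projection Q"
      using Q centre projection_mem is_projection by blast+
    moreover have "right_invertible_in M C"
      using C by (auto simp: right_invertible_in_def fun_eq_iff)
    moreover have "(\<lambda>x. Q x + ?Q' x) = id" by (simp add: fun_eq_iff)
    ultimately show ?case
      using C(1) eqs by (intro bexI[of _ C] conjI bexI[of _ Q] bexI[of _ ?Q']) (auto simp: fun_eq_iff)
  next
    case 2
    then obtain C D P Q where C: "D \<in> M" "C \<circ> D = id" and P: "P \<in> centre M" "is_projection P"
      and Q: "Q \<in> centre M" "is_projection Q" and PQ: "(\<lambda>x. P x + Q x) = id"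
      and eqs: "A1 \<circ> P = A2 \<circ> C \<circ> P" "B1 \<circ> P = B2 \<circ> C \<circ> P"
        "A2 \<circ> Q = A1 \<circ> C \<circ> Q" "B2 \<circ> Q = B1 \<circ> C \<circ> Q"
      unfolding right_invertible_in_def by blast
    have CD: "C (D x) = x" for x using fun_cong[OF C(2), of x] by simp
    have sum: "P x + Q x = x" "Q x + P x = x" for x
      using fun_cong[OF PQ, of x] by (simp_all add: add.commute)
    have idem: "P (P x) = P x" "Q (Q x) = Q x" for x
      using P(2) Q(2) by (auto simp: is_projection_def dest: fun_cong[where x = x])
    have comm: "P (D x) = D (P x)" "Q (D x) = D (Q x)" for x
    proof -
      have "P \<circ> D = D \<circ> P" "Q \<circ> D = D \<circ> Q" using P(1) Q(1) C(1) by (auto simp: centre_def)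
      then show "P (D x) = D (P x)" "Q (D x) = D (Q x)" by (auto dest: fun_cong[where x = x])
    qed
    have eqs': "A1 (P x) = A2 (C (P x))" "B1 (P x) = B2 (C (P x))"
      "A2 (Q x) = A1 (C (Q x))" "B2 (Q x) = B1 (C (Q x))" for x
      using eqs[THEN fun_cong, of x] by simp_all
    have lift: "\<exists>y. B2 y = B1 x \<and> A2 y = A1 x" for x
      by (rule intertwined_lift[where C = C and D = D and P = P and Q = Q])
        (use assms CD sum idem comm eqs' in auto)
    \<comment> \<open>The same argument with the indices and the two central projections
      exchanged.\<close>
    have lift': "\<exists>y. B1 y = B2 x \<and> A1 y = A2 x" for x
      by (rule intertwined_lift[where C = C and D = D and P = Q and Q = P])
        (use assms CD sum idem comm eqs' in auto)
    \<comment> \<open>The lift \<open>z\<close> of \<open>x\<close> and the vector \<open>y\<close>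
      have the same image under \<open>B2\<close>, so \<open>A2\<close> kills their
      difference.\<close>
    have "A1 x = A2 y" if "B1 x = B2 y" for x y
    proof -
      obtain z where z: "B2 z = B1 x" "A2 z = A1 x" using lift by blast
      then have "z - y \<in> null_space B2"
        using that by (simp add: null_space_def mem_diff[OF assms(6)])
      then have "A2 (z - y) = 0" using assms(7) by (auto simp: null_space_def)
      then show ?thesis using z by (simp add: mem_diff[OF assms(5)])
    qed
    moreover have "range B1 = range B2"
      using lift lift' by (metis (no_types, lifting) image_subset_iff rangeI subset_antisym)
    ultimately show ?case by blast
  qed
qed

end
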